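(* The following properties hold true. 1. Let $\mathbf{D}$ be an ellipse with semi-axes $0<b\leqslant a$. Then there exists a countable set $\mathcal{G}_E\subset(1,\infty)$ such that condition (ND) below holds for $\mathbf{D}$ if and only if $\frac ab\notin\mathcal{G}_E$. 2. Let $\mathbf{D}$ be a rectangle with sides $0<l\leqslant L$. Then there exists a countable set $\mathcal{G}_R\subset(0,1)$ such that condition (ND) below holds for $\mathbf{D}$ if and only if $\frac lL\notin\mathcal{G}_R$. Condition (ND) for a bounded convex domain $\mathbf{D}$: the conformal mapping $F:\mathbb{D}\to\mathbf{D}$ with $F(0)=\xi_0$, where $\xi_0$ is the unique critical point of the Robin function of $\mathbf{D}$, satisfies $$\left|\frac{F^{(3)}(0)}{F'(0)}\right|\notin\Big\{2\sqrt{1-\tfrac1{n^2}}\,:\ n\in\mathbb{N}^*\cup\{\infty\}\Big\}.$$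
   Context: $\mathbb{D}$ is the open unit disc and $\mathbb{N}^*=\{1,2,\dots\}$; for $n=\infty$ the value $2\sqrt{1-1/n^2}$ is $2$. The Robin function of a simply connected bounded domain $\mathbf{D}$ is $\mathcal{R}_{\mathbf{D}}(z)=\log\frac{|\Phi'(z)|}{1-|\Phi(z)|^2}$ for any conformal bijection $\Phi:\mathbf{D}\to\mathbb{D}$; on a bounded convex domain it has exactly one critical point. Condition (ND) does not depend on the choice of $F$ (which is unique up to precomposition with a rotation). Ellipses and rectangles here denote the open convex planar domains. Condition (ND) is the hypothesis, for bounded convex domains, of a result which desingularizes periodic point vortex orbits in $\mathbf{D}$ into time-periodic vortex patches of the Euler equations.
   Formalization: For a=b (disc) and l=L (square) the printed equivalence fails: F'''(0)=0 is the forbidden value for n=1, yet ratio 1 lies outside G_E and G_R. The formal statement says (ND) holds iff a≠b and a/b∉G_E, respectively iff l≠L and l/L∉G_R. *)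

theory Defs
  imports "HOL-Complex_Analysis.Complex_Analysis"
begin

definition conformal_bij :: "(complex \<Rightarrow> complex) \<Rightarrow> complex set \<Rightarrow> complex set \<Rightarrow> bool" where
  "conformal_bij f A B \<longleftrightarrow> f holomorphic_on A \<and> bij_betw f A B"

(* The value does not depend on the conformal bijection: two of them differ by an
   automorphism of the disc, and log(|f'| / (1 - |f|^2)) is invariant under those. *)
definition robin :: "complex set \<Rightarrow> complex \<Rightarrow> real" where
  "robin D z = (let \<Phi> = (SOME \<Phi>. conformal_bij \<Phi> D (ball 0 1))
                in ln (cmod (deriv \<Phi> z) / (1 - (cmod (\<Phi> z))\<^sup>2)))"

(* Vanishing of the real gradient, with the plane identified with the complex numbers. *)
definition critical_point :: "(complex \<Rightarrow> real) \<Rightarrow> complex \<Rightarrow> bool" where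
  "critical_point f z \<longleftrightarrow> (f has_derivative (\<lambda>_. 0)) (at z)"

definition robin_critical_point :: "complex set \<Rightarrow> complex" where
  "robin_critical_point D = (THE \<xi>. \<xi> \<in> D \<and> critical_point (robin D) \<xi>)"

definition resonant_values :: "real set" where
  "resonant_values = {2 * sqrt (1 - 1 / (real n)\<^sup>2) |n::nat. n \<ge> 1} \<union> {2}"

(* F is determined up to precomposition with a rotation, under which the modulus below is
   invariant, so it makes no difference whether some or every such F is required to satisfy
   the condition; the existential form is false, not vacuously true, when there is none. *)
definition ND :: "complex set \<Rightarrow> bool" where
  "ND D \<longleftrightarrow> (\<exists>F. conformal_bij F (ball 0 1) D \<and> F 0 = robin_critical_point D \<and>
     cmod ((deriv ^^ 3) F 0 / deriv F 0) \<notin> resonant_values)"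

(* Ellipses and rectangles may be in arbitrary position: c is the centre, and the
   multiplication by u rotates the axes. *)
definition is_ellipse :: "real \<Rightarrow> real \<Rightarrow> complex set \<Rightarrow> bool" where
  "is_ellipse a b D \<longleftrightarrow> (\<exists>c u. cmod u = 1 \<and>
     D = {c + u * z |z. (Re z / a)\<^sup>2 + (Im z / b)\<^sup>2 < 1})"

definition is_rectangle :: "real \<Rightarrow> real \<Rightarrow> complex set \<Rightarrow> bool" where
  "is_rectangle L l D \<longleftrightarrow> (\<exists>c u. cmod u = 1 \<and>
     D = {c + u * z |z. \<bar>Re z\<bar> < L / 2 \<and> \<bar>Im z\<bar> < l / 2})"

end

(* Let f map the disc conformally onto a bounded convex domain D. Then the Robin function satisfies
   R(f(0)) = - log |f'(0)|, so f(0) is critical exactly when f''(0) = 0. If a second critical point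
   existed, equality in a second-order Schwarz lemma would force f' = f'(0) / (1 - c z^2) with |c| = 1,
   and f would be unbounded. For a centrally symmetric D the critical point is therefore the centre.

   For the centre 0, any function P that is holomorphic on D with a single simple zero at 0 and has
   modulus 1 on the boundary is, up to rotation, the inverse of the Riemann map F, whence
   |F'''(0) / F'(0)| = |P'''(0)| / |P'(0)|^3. Such a P is s * exp(h), where h solves a Dirichlet problem
   by a series in Chebyshev polynomials (ellipse) or in cosh (rectangle). The resulting modulus is
   real analytic and nonconstant in a parameter of the shape (a nome), so that each of the countably
   many resonant values is taken for at most countably many shapes. *)
theory Submission
  imports Defs
begin

section \<open>Conformal bijections of the disc\<close>

text \<open>Both exceptional sets exclude the ratio 1, so discs and squares need their own argument:
  a quarter-turn symmetry forces F'''(0) = 0, and 0 is the resonant value for n = 1, so (ND) fails.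
  Hence the separate clauses \<open>a \<noteq> b\<close> and \<open>l \<noteq> L\<close> in the
  conclusion. Finding P amounts to finding the Green function - ln |P| with pole at 0: ln |s|
  supplies the singularity, and Re h has to equal - ln |s| on the boundary. Expanding this datum in
  modes and dividing each one by its amplitude cosh (2 k t) on the boundary produces the factors exp
  (- 2 k t) / (2 cosh (2 k t)) = q^k / (1 + q^k) with q = exp (- 4 t). The resulting Lambert series
  are holomorphic for |q| < 1, including q = 0, the limit shape (disc or infinite strip);
  nonconstancy is read off from a derivative there, without any monotonicity or estimate of special
  functions. For rectangles, countable cannot be sharpened to finite: as the nome tends to 0 the
  modulus tends to 2 from below, and 2 is the accumulation point of the resonant values.\<close>

lemma conformal_bij_inverse:
  assumes f: "conformal_bij f A B" and "open A"
  shows "\<exists>g. conformal_bij g B A \<and> (\<forall>z\<in>A. g (f z) = z) \<and> (\<forall>w\<in>B. f (g w) = w)"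
    and "z \<in> A \<Longrightarrow> deriv f z \<noteq> 0"
proof -
  have hol: "f holomorphic_on A" and inj: "inj_on f A" and im: "f ` A = B"
    using f by (auto simp: conformal_bij_def bij_betw_def)
  obtain g where g: "g holomorphic_on f ` A"
    "\<And>z. z \<in> A \<Longrightarrow> deriv f z * deriv g (f z) = 1" "\<And>z. z \<in> A \<Longrightarrow> g (f z) = z"
    using holomorphic_has_inverse[OF hol \<open>open A\<close> inj] by blast
  have "bij_betw g B A"
    by (rule bij_betw_byWitness[where f' = f]) (use g(3) im in auto)
  then have "conformal_bij g B A"
    using g(1) im by (auto simp: conformal_bij_def)
  moreover have "\<forall>w\<in>B. f (g w) = w"
    using g(3) im by auto
  ultimately show "\<exists>g. conformal_bij g B A \<and> (\<forall>z\<in>A. g (f z) = z) \<and> (\<forall>w\<in>B. f (g w) = w)"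
    using g(3) by blast
  show "deriv f z \<noteq> 0" if "z \<in> A"
    using g(2)[OF that] by auto
qed

lemma conformal_bij_memD:
  assumes "conformal_bij f A B" "z \<in> A"
  shows "f z \<in> B"
  using assms by (auto simp: conformal_bij_def bij_betw_def)

lemma conformal_bij_compose:
  assumes "conformal_bij f A B" "conformal_bij g B C"
  shows "conformal_bij (g \<circ> f) A C"
  using assms by (auto simp: conformal_bij_def bij_betw_def intro: holomorphic_on_compose comp_inj_on)

lemma conformal_bij_open_image:
  assumes "conformal_bij f A B" "open A"
  shows "open B"
  using assms open_mapping_thm3 by (metis bij_betw_def conformal_bij_def)

lemma conformal_bij_mult_unit:
  assumes "cmod u = 1"
  shows "conformal_bij (\<lambda>z. u * z) (ball 0 1) (ball 0 1)"
proof -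
  have "bij_betw (\<lambda>z. u * z) (ball 0 1) (ball 0 1)"
    by (rule bij_betw_byWitness[where f' = "\<lambda>z. z / u"])
      (use assms in \<open>auto simp: norm_mult norm_divide\<close>)
  then show ?thesis
    by (auto simp: conformal_bij_def intro!: holomorphic_intros)
qed

text \<open>The automorphism of the disc taking 0 to \<open>w\<close>. Composing a conformal map
  with it moves the base point, so facts about derivatives at 0 yield facts at every point of the
  domain.\<close>

definition disc_aut :: "complex \<Rightarrow> complex \<Rightarrow> complex" where
  "disc_aut w z = (z + w) / (1 + cnj w * z)"

lemma disc_aut_0 [simp]: "disc_aut w 0 = w"
  by (simp add: disc_aut_def)

lemma disc_aut_eq_Moebius: "disc_aut w = Moebius_function 0 (- w)"
  by (auto simp: disc_aut_def Moebius_function_simple)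

lemma conformal_bij_disc_aut:
  assumes "cmod w < 1"
  shows "conformal_bij (disc_aut w) (ball 0 1) (ball 0 1)"
proof -
  have "bij_betw (disc_aut w) (ball 0 1) (ball 0 1)"
  proof (rule bij_betw_byWitness[where f' = "Moebius_function 0 w"])
    show "\<forall>z\<in>ball 0 1. Moebius_function 0 w (disc_aut w z) = z"
      using Moebius_function_compose[of w "- w"] assms by (simp add: disc_aut_eq_Moebius)
    show "\<forall>z\<in>ball 0 1. disc_aut w (Moebius_function 0 w z) = z"
      using Moebius_function_compose[of "- w" w] assms by (simp add: disc_aut_eq_Moebius)
    show "disc_aut w ` ball 0 1 \<subseteq> ball 0 1" "Moebius_function 0 w ` ball 0 1 \<subseteq> ball 0 1"
      using Moebius_function_norm_lt_1[of w] Moebius_function_norm_lt_1[of "- w"] assms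
      by (auto simp: disc_aut_eq_Moebius)
  qed
  moreover have "disc_aut w holomorphic_on ball 0 1"
    using Moebius_function_holomorphic[of "- w"] assms by (simp add: disc_aut_eq_Moebius)
  ultimately show ?thesis
    by (simp add: conformal_bij_def)
qed

lemma norm_mult_disc_less_1:
  fixes w z :: complex
  assumes "cmod w < 1" "cmod z < 1"
  shows "cmod (cnj w * z) < 1"
  using assms by (metis complex_mod_cnj mult.left_neutral norm_mult norm_mult_less)

lemma disc_aut_denom_nz:
  assumes "cmod w < 1" "cmod z < 1"
  shows "1 + cnj w * z \<noteq> 0"
  using norm_mult_disc_less_1[OF assms]
  by (metis add_eq_0_iff norm_minus_cancel norm_one less_irrefl)

lemma has_field_derivative_disc_aut:
  assumes "cmod w < 1" "cmod z < 1"
  shows "(disc_aut w has_field_derivative (1 - (cmod w)\<^sup>2) / (1 + cnj w * z)\<^sup>2) (at z)"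
proof -
  have "cnj w * w = of_real ((cmod w)\<^sup>2)"
    by (metis complex_norm_square mult.commute of_real_power)
  then show ?thesis
    unfolding disc_aut_def
    using disc_aut_denom_nz[OF assms]
    by (auto intro!: derivative_eq_intros simp: field_simps power2_eq_square)
qed

text \<open>The Schwarz lemma for \<open>f\<close> and for its inverse gives opposite inequalities,
  hence \<open>cmod (f z) = cmod z\<close>; equality at one nonzero point, for which 1/2 serves,
  already forces a rotation.\<close>

lemma conformal_bij_disc_fixing_0:
  assumes f: "conformal_bij f (ball 0 1) (ball 0 1)" and "f 0 = 0"
  obtains u where "cmod u = 1" "\<And>z. cmod z < 1 \<Longrightarrow> f z = u * z"
proof -
  obtain g where g: "conformal_bij g (ball 0 1) (ball 0 1)" "\<And>z. z \<in> ball 0 1 \<Longrightarrow> g (f z) = z"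
    using conformal_bij_inverse(1)[OF f open_ball] by blast
  have "g 0 = 0"
    using g(2)[of 0] \<open>f 0 = 0\<close> by simp
  have fb: "cmod (f z) < 1" if "cmod z < 1" for z
    using conformal_bij_memD[OF f, of z] that by simp
  have gb: "cmod (g z) < 1" if "cmod z < 1" for z
    using conformal_bij_memD[OF g(1), of z] that by simp
  have fh: "f holomorphic_on ball 0 1" and gh: "g holomorphic_on ball 0 1"
    using f g by (auto simp: conformal_bij_def)
  have "cmod (f z) = cmod z" if "cmod z < 1" for z
    using Schwarz_Lemma(1)[OF fh \<open>f 0 = 0\<close> fb that]
      Schwarz_Lemma(1)[OF gh \<open>g 0 = 0\<close> gb fb[OF that]] g(2)[of z] that by simp
  from this[of "1/2"] have "\<exists>z. cmod z < 1 \<and> z \<noteq> 0 \<and> cmod (f z) = cmod z"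
    by (intro exI[of _ "1/2"]) auto
  then obtain u where "cmod u = 1" "\<And>z. cmod z < 1 \<Longrightarrow> f z = u * z"
    using Schwarz_Lemma(3)[OF fh \<open>f 0 = 0\<close> fb, of 0] by auto
  then show thesis
    by (rule that)
qed

lemma conformal_bij_unique_rotation:
  assumes f: "conformal_bij f (ball 0 1) D" and g: "conformal_bij g (ball 0 1) D" and "f 0 = g 0"
  obtains u where "cmod u = 1" "\<And>z. cmod z < 1 \<Longrightarrow> g z = f (u * z)"
proof -
  obtain f' where f': "conformal_bij f' D (ball 0 1)" "\<And>z. z \<in> ball 0 1 \<Longrightarrow> f' (f z) = z"
      "\<And>w. w \<in> D \<Longrightarrow> f (f' w) = w"
    using conformal_bij_inverse(1)[OF f open_ball] by blast
  have "(f' \<circ> g) 0 = 0"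
    using f'(2)[of 0] \<open>f 0 = g 0\<close> by simp
  then obtain u where u: "cmod u = 1" "\<And>z. cmod z < 1 \<Longrightarrow> (f' \<circ> g) z = u * z"
    using conformal_bij_disc_fixing_0[OF conformal_bij_compose[OF g f'(1)]] by metis
  have "g z = f (u * z)" if "cmod z < 1" for z
  proof -
    have "g z \<in> D"
      using conformal_bij_memD[OF g] that by simp
    then show ?thesis
      using u(2)[OF that] f'(3)[of "g z"] by simp
  qed
  with u(1) that show thesis by blast
qed

text \<open>Two divisions by \<open>z\<close>. The quotient \<open>h1\<close> keeps modulus strictly
  below 1, since equality would make \<open>h\<close> a rotation, against
  \<open>deriv h 0 = 0\<close>; it vanishes at 0, so the Schwarz lemma applies again. The bound on
  \<open>k\<close> is not strict: its equality case decides the uniqueness of the critical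
  point.\<close>

lemma Schwarz_second_order:
  assumes h: "h holomorphic_on ball 0 1" and "h 0 = 0" "deriv h 0 = 0"
    and bound: "\<And>z. cmod z < 1 \<Longrightarrow> cmod (h z) < 1"
  obtains k where "k holomorphic_on ball 0 1" "\<And>z. cmod z < 1 \<Longrightarrow> h z = z\<^sup>2 * k z"
    "\<And>z. cmod z < 1 \<Longrightarrow> cmod (k z) \<le> 1"
proof -
  obtain h1 where h1: "h1 holomorphic_on ball 0 1" "\<And>z. cmod z < 1 \<Longrightarrow> h z = z * h1 z" "h1 0 = 0"
    using Schwarz3[OF h \<open>h 0 = 0\<close>] \<open>deriv h 0 = 0\<close> by metis
  have lt: "cmod (h1 z) < 1" if "cmod z < 1" for z
  proof (cases "z = 0")
    case False
    have "cmod (h z) \<noteq> cmod z"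
    proof
      assume "cmod (h z) = cmod z"
      then obtain \<alpha> where \<alpha>: "\<And>z. cmod z < 1 \<Longrightarrow> h z = \<alpha> * z" "cmod \<alpha> = 1"
        using Schwarz_Lemma(3)[OF h \<open>h 0 = 0\<close> bound, of z] False \<open>cmod z < 1\<close> by blast
      have "(h has_field_derivative \<alpha>) (at 0)"
        by (rule has_field_derivative_transform_within_open[where f = "\<lambda>z. \<alpha> * z" and S = "ball 0 1"])
          (auto intro!: derivative_eq_intros simp: \<alpha>(1))
      then show False
        using DERIV_imp_deriv \<open>deriv h 0 = 0\<close> \<alpha>(2) by fastforce
    qed
    then have "cmod (h z) < cmod z"
      using Schwarz_Lemma(1)[OF h \<open>h 0 = 0\<close> bound that] by linarith
    then show ?thesis
      using h1(2)[OF that] False by (simp add: norm_mult)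
  qed (simp add: h1)
  obtain k where k: "k holomorphic_on ball 0 1" "\<And>z. cmod z < 1 \<Longrightarrow> h1 z = z * k z" "deriv h1 0 = k 0"
    using Schwarz3[OF h1(1,3)] by metis
  have "cmod (k z) \<le> 1" if "cmod z < 1" for z
  proof (cases "z = 0")
    case True
    then show ?thesis
      using Schwarz_Lemma(2)[OF h1(1,3) lt that] k(3) by simp
  next
    case False
    have "cmod z * cmod (k z) \<le> cmod z"
      using Schwarz_Lemma(1)[OF h1(1,3) lt that] k(2)[OF that] by (simp add: norm_mult)
    then show ?thesis
      using False by simp
  qed
  then show thesis
    using that[OF k(1)] h1(2) k(2) by (simp add: power2_eq_square)
qed

section \<open>The Robin function and its critical points on convex domains\<close>

text \<open>By convexity the even part of \<open>f\<close> maps into \<open>D\<close>; pulled back by the inverse of \<open>f\<close> it is a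
  self-map of the disc with a double zero, whose leading coefficient is \<open>f'' / (2 f')\<close> at \<open>0\<close>.\<close>

lemma norm_second_deriv_bound_convex:
  assumes f: "conformal_bij f (ball 0 1) D" and "convex D"
  shows "cmod (deriv (deriv f) 0) \<le> 2 * cmod (deriv f 0)"
proof -
  have "open D"
    using conformal_bij_open_image[OF f] by simp
  have fh: "f holomorphic_on ball 0 1" and fD: "\<And>z. cmod z < 1 \<Longrightarrow> f z \<in> D"
    using f conformal_bij_memD[OF f] by (auto simp: conformal_bij_def)
  obtain g where g: "conformal_bij g D (ball 0 1)" "\<And>z. z \<in> ball 0 1 \<Longrightarrow> g (f z) = z"
    using conformal_bij_inverse(1)[OF f open_ball] by blast
  have gh: "g holomorphic_on D"
    using g by (simp add: conformal_bij_def)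
  define E where "E = (\<lambda>z. (f z + f (- z)) / 2)"
  define E' where "E' = (\<lambda>z. (deriv f z - deriv f (- z)) / 2)"
  define h where "h = g \<circ> E"
  have ED: "E z \<in> D" if "cmod z < 1" for z
  proof -
    have "(1/2) *\<^sub>R f z + (1/2) *\<^sub>R f (- z) \<in> D"
      using \<open>convex D\<close> fD[of z] fD[of "- z"] that by (intro convexD) auto
    then show ?thesis
      by (simp add: E_def scaleR_conv_of_real add_divide_distrib)
  qed
  have f': "(f has_field_derivative deriv f z) (at z)" 
    and f'': "(deriv f has_field_derivative deriv (deriv f) z) (at z)" if "cmod z < 1" for z
    using that holomorphic_derivI[OF fh] holomorphic_derivI[OF holomorphic_deriv[OF fh]] by auto
  have neg: "((\<lambda>z. F (- z)) has_field_derivative - F' ) (at z)"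
    if "(F has_field_derivative F') (at (- z))" for F F' and z :: complex
  proof -
    have "(uminus has_field_derivative - 1) (at z)"
      by (auto intro!: derivative_eq_intros)
    from DERIV_chain2[where f = F and g = uminus and x = z, OF that this]
    show ?thesis by simp
  qed
  have E': "(E has_field_derivative E' z) (at z)" if "cmod z < 1" for z
    unfolding E_def E'_def
    by (rule derivative_eq_intros f' neg refl that | use that in simp)+
  have E'': "(E' has_field_derivative deriv (deriv f) 0) (at 0)"
    unfolding E'_def
    by (rule derivative_eq_intros f'' neg refl | simp)+
  have Eh: "E holomorphic_on ball 0 1"
    unfolding holomorphic_on_open[OF open_ball] using E' by (metis mem_ball_0)
  have hh: "h holomorphic_on ball 0 1"
    unfolding h_def using ED by (intro holomorphic_on_compose_gen[OF Eh gh]) auto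
  have h': "(h has_field_derivative deriv g (E z) * E' z) (at z)" if "cmod z < 1" for z
    unfolding h_def
    by (intro DERIV_chain E' that holomorphic_derivI[OF gh \<open>open D\<close>] ED)
  have E0: "E 0 = f 0" "E' 0 = 0"
    by (simp_all add: E_def E'_def)
  have h0: "h 0 = 0"
    using g(2)[of 0] by (simp add: h_def E0)
  have dh: "deriv h z = deriv g (E z) * E' z" if "cmod z < 1" for z
    using h'[OF that] by (rule DERIV_imp_deriv)
  have hb: "cmod (h z) < 1" if "cmod z < 1" for z
    using conformal_bij_memD[OF g(1) ED[OF that]] by (simp add: h_def)
  obtain k where k: "k holomorphic_on ball 0 1" "\<And>z. cmod z < 1 \<Longrightarrow> h z = z\<^sup>2 * k z"
    "\<And>z. cmod z < 1 \<Longrightarrow> cmod (k z) \<le> 1"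
    using Schwarz_second_order[OF hh h0 _ hb] dh[of 0] E0 by auto
  have k': "(k has_field_derivative deriv k z) (at z)" if "cmod z < 1" for z
    using that holomorphic_derivI[OF k(1)] by auto
  have h'k: "deriv h z = 2 * z * k z + z\<^sup>2 * deriv k z" if "cmod z < 1" for z
  proof (rule DERIV_imp_deriv, rule has_field_derivative_transform_within_open[where S = "ball 0 1"])
    show "((\<lambda>z. z\<^sup>2 * k z) has_field_derivative 2 * z * k z + z\<^sup>2 * deriv k z) (at z)"
      by (auto intro!: derivative_eq_intros k' that)
  qed (use that k(2) in auto)
  \<comment> \<open>The second derivative of \<open>h\<close> at 0 is computed twice, here from the
    factorization and below from the chain rule, where the term with \<open>deriv (deriv g)\<close>
    drops out because \<open>E' 0 = 0\<close>.\<close>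
  have "(deriv h has_field_derivative 2 * k 0) (at 0)"
  proof (rule has_field_derivative_transform_within_open[where S = "ball 0 1"])
    have "deriv k holomorphic_on ball 0 1"
      by (intro holomorphic_intros k(1)) auto
    then have "(deriv k has_field_derivative deriv (deriv k) 0) (at 0)"
      using holomorphic_derivI by fastforce
    then show "((\<lambda>z. 2 * z * k z + z\<^sup>2 * deriv k z) has_field_derivative 2 * k 0) (at 0)"
      by (auto intro!: derivative_eq_intros k')
  qed (use h'k in auto)
  moreover have "(deriv h has_field_derivative deriv g (f 0) * deriv (deriv f) 0) (at 0)"
  proof (rule has_field_derivative_transform_within_open[where S = "ball 0 1"])
    have "((\<lambda>z. deriv g (E z)) has_field_derivative deriv (deriv g) (E 0) * E' 0) (at 0)"
      by (intro DERIV_chain2[where f = "deriv g"] E'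
        holomorphic_derivI[OF holomorphic_deriv[OF gh \<open>open D\<close>] \<open>open D\<close>] ED) auto
    then show "((\<lambda>z. deriv g (E z) * E' z) has_field_derivative deriv g (f 0) * deriv (deriv f) 0) (at 0)"
      by (auto intro!: derivative_eq_intros E'' simp: E0)
  qed (use dh in auto)
  ultimately have "2 * k 0 = deriv g (f 0) * deriv (deriv f) 0"
    by (rule DERIV_unique)
  moreover have "deriv g (f 0) * deriv f 0 = 1"
  proof (rule DERIV_unique)
    show "(g \<circ> f has_field_derivative deriv g (f 0) * deriv f 0) (at 0)"
      by (intro DERIV_chain f' holomorphic_derivI[OF gh \<open>open D\<close>] fD) auto
    show "(g \<circ> f has_field_derivative 1) (at 0)"
      by (rule has_field_derivative_transform_within_open[where f = "\<lambda>z. z" and S = "ball 0 1"])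
        (use g(2) in auto)
  qed
  ultimately have "deriv (deriv f) 0 = 2 * k 0 * deriv f 0"
    by (simp add: mult.assoc mult.left_commute)
  then show ?thesis
    using k(3)[of 0] by (simp add: norm_mult mult_left_le_one_le)
qed

text \<open>Moving the base point to \<open>w\<close> turns the condition f''(0) = 0 into an
  equation at \<open>w\<close>. For conformal \<open>f\<close>, the second expression vanishes
  exactly when \<open>f w\<close> is a critical point of the Robin function.\<close>

lemma compose_disc_aut_derivs:
  assumes fh: "f holomorphic_on ball 0 1" and w: "cmod w < 1"
  shows "deriv (f \<circ> disc_aut w) 0 = deriv f w * (1 - (cmod w)\<^sup>2)"
    and "deriv (deriv (f \<circ> disc_aut w)) 0 =
      deriv (deriv f) w * (1 - (cmod w)\<^sup>2)\<^sup>2 - 2 * cnj w * (1 - (cmod w)\<^sup>2) * deriv f w"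
proof -
  define r where "r = complex_of_real (1 - (cmod w)\<^sup>2)"
  have f': "(f has_field_derivative deriv f z) (at z)" 
    and f'': "(deriv f has_field_derivative deriv (deriv f) z) (at z)" if "cmod z < 1" for z
    using that holomorphic_derivI[OF fh] holomorphic_derivI[OF holomorphic_deriv[OF fh]] by auto
  have m: "(disc_aut w has_field_derivative r / (1 + cnj w * z)\<^sup>2) (at z)" if "cmod z < 1" for z
    using has_field_derivative_disc_aut[OF w that] by (simp add: r_def)
  have lt: "cmod (disc_aut w z) < 1" if "cmod z < 1" for z
    using conformal_bij_memD[OF conformal_bij_disc_aut[OF w]] that by simp
  have d: "deriv (f \<circ> disc_aut w) z = deriv f (disc_aut w z) * (r / (1 + cnj w * z)\<^sup>2)"
    if "cmod z < 1" for z
    by (intro DERIV_imp_deriv DERIV_chain f' lt m that)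
  show "deriv (f \<circ> disc_aut w) 0 = deriv f w * (1 - (cmod w)\<^sup>2)"
    using d[of 0] by (simp add: r_def)
  have "((\<lambda>z. deriv f (disc_aut w z)) has_field_derivative deriv (deriv f) w * r) (at 0)"
    using DERIV_chain2[OF f''[OF lt] m, of 0] by simp
  then have "((\<lambda>z. deriv f (disc_aut w z) * (r / (1 + cnj w * z)\<^sup>2)) has_field_derivative
      deriv (deriv f) w * r\<^sup>2 - 2 * cnj w * r * deriv f w) (at 0)"
    by (auto intro!: derivative_eq_intros simp: power2_eq_square algebra_simps)
  then have "(deriv (f \<circ> disc_aut w) has_field_derivative
      deriv (deriv f) w * r\<^sup>2 - 2 * cnj w * r * deriv f w) (at 0)"
    by (rule has_field_derivative_transform_within_open[where S = "ball 0 1"]) (use d in auto)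
  then show "deriv (deriv (f \<circ> disc_aut w)) 0 =
      deriv (deriv f) w * (1 - (cmod w)\<^sup>2)\<^sup>2 - 2 * cnj w * (1 - (cmod w)\<^sup>2) * deriv f w"
    by (simp add: DERIV_imp_deriv r_def)
qed

text \<open>The map picked by \<open>SOME\<close> need not send \<open>f 0\<close> to 0. Composing
  its inverse \<open>F\<close> with \<open>disc_aut w\<close> gives a map with the same value at 0
  as \<open>f\<close>, hence a rotation of \<open>f\<close>; the factor
  \<open>1 - (cmod w)^2\<close> in its derivative is the denominator in
  \<open>robin\<close>.\<close>

lemma robin_eq:
  assumes f: "conformal_bij f (ball 0 1) D"
  shows "robin D (f 0) = - ln (cmod (deriv f 0))"
proof -
  have "open D"
    using conformal_bij_open_image[OF f] by simp
  define P where "P = (SOME P. conformal_bij P D (ball 0 1))"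
  have P: "conformal_bij P D (ball 0 1)"
    unfolding P_def using conformal_bij_inverse(1)[OF f open_ball] by (metis someI_ex)
  obtain F where F: "conformal_bij F (ball 0 1) D" "\<And>z. z \<in> D \<Longrightarrow> F (P z) = z"
    "\<And>z. z \<in> ball 0 1 \<Longrightarrow> P (F z) = z"
    using conformal_bij_inverse(1)[OF P \<open>open D\<close>] by blast
  have f0: "f 0 \<in> D"
    using conformal_bij_memD[OF f] by simp
  define w where "w = P (f 0)"
  have w: "cmod w < 1"
    using conformal_bij_memD[OF P f0] by (simp add: w_def)
  have Fw: "F w = f 0"
    using F(2)[OF f0] by (simp add: w_def)
  have Fh: "F holomorphic_on ball 0 1" and Ph: "P holomorphic_on D"
    using F P by (auto simp: conformal_bij_def)
  have PF: "deriv P (f 0) * deriv F w = 1"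
  proof (rule DERIV_unique)
    show "(P \<circ> F has_field_derivative deriv P (f 0) * deriv F w) (at w)"
      using w f0 Fw
      by (intro DERIV_chain holomorphic_derivI[OF Fh] holomorphic_derivI[OF Ph \<open>open D\<close>, of "F w", unfolded Fw]) 
        (auto intro!: holomorphic_derivI[OF Ph \<open>open D\<close>, of "f 0"])
    show "(P \<circ> F has_field_derivative 1) (at w)"
      by (rule has_field_derivative_transform_within_open[where f = "\<lambda>z. z" and S = "ball 0 1"])
        (use F(3) w in auto)
  qed
  have comp: "conformal_bij (F \<circ> disc_aut w) (ball 0 1) D"
    by (rule conformal_bij_compose[OF conformal_bij_disc_aut[OF w] F(1)])
  obtain u where u: "cmod u = 1" "\<And>z. cmod z < 1 \<Longrightarrow> f z = (F \<circ> disc_aut w) (u * z)"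
    using conformal_bij_unique_rotation[OF comp f] by (metis Fw comp_apply disc_aut_0)
  have "((F \<circ> disc_aut w) has_field_derivative deriv (F \<circ> disc_aut w) 0) (at (u * 0))"
    using comp holomorphic_derivI[of "F \<circ> disc_aut w" "ball 0 1" 0] by (simp add: conformal_bij_def)
  from DERIV_chain2[OF this DERIV_cmult_Id]
  have "((\<lambda>z. (F \<circ> disc_aut w) (u * z)) has_field_derivative deriv (F \<circ> disc_aut w) 0 * u) (at 0)" .
  then have "(f has_field_derivative deriv (F \<circ> disc_aut w) 0 * u) (at 0)"
    by (rule has_field_derivative_transform_within_open[where S = "ball 0 1"]) (use u in auto)
  then have "cmod (deriv f 0) = cmod (deriv (F \<circ> disc_aut w) 0)"
    by (simp add: DERIV_imp_deriv norm_mult u(1))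
  also have "\<dots> = cmod (deriv F w) * (1 - (cmod w)\<^sup>2)"
  proof -
    have "cmod (complex_of_real (1 - (cmod w)\<^sup>2)) = 1 - (cmod w)\<^sup>2"
      using w by (simp only: norm_of_real) (simp add: abs_square_le_1 less_imp_le)
    then show ?thesis
      using compose_disc_aut_derivs(1)[OF Fh w] by (simp add: norm_mult)
  qed
  also have "cmod (deriv F w) = 1 / cmod (deriv P (f 0))"
    using PF by (metis div_by_1 nonzero_eq_divide_eq norm_mult norm_one mult.commute mult_eq_0_iff norm_eq_zero zero_neq_one)
  finally have "cmod (deriv P (f 0)) / (1 - (cmod w)\<^sup>2) = inverse (cmod (deriv f 0))"
    by (simp add: field_simps)
  then show ?thesis
    unfolding robin_def P_def[symmetric] w_def[symmetric] Let_def by (simp add: ln_inverse)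
qed

text \<open>Pulled back by \<open>f\<close>, the Robin function is \<open>R\<close>. The term
  \<open>ln (1 - (cmod z)^2)\<close> has zero differential at 0, so only the quotient
  \<open>c\<close> of the second by the first derivative remains. The chain rule carries criticality
  along \<open>f\<close> and along its inverse \<open>g\<close>.\<close>

lemma critical_point_robin_iff:
  assumes f: "conformal_bij f (ball 0 1) D"
  shows "critical_point (robin D) (f 0) \<longleftrightarrow> deriv (deriv f) 0 = 0"
proof -
  have "open D"
    using conformal_bij_open_image[OF f] by simp
  have fh: "f holomorphic_on ball 0 1" and fD: "\<And>z. cmod z < 1 \<Longrightarrow> f z \<in> D"
    using f conformal_bij_memD[OF f] by (auto simp: conformal_bij_def)
  obtain g where g: "conformal_bij g D (ball 0 1)" "\<And>z. z \<in> ball 0 1 \<Longrightarrow> g (f z) = z"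
    "\<And>w. w \<in> D \<Longrightarrow> f (g w) = w"
    using conformal_bij_inverse(1)[OF f open_ball] by blast
  have f': "(f has_field_derivative deriv f z) (at z)" 
    and f'': "(deriv f has_field_derivative deriv (deriv f) z) (at z)" if "cmod z < 1" for z
    using that holomorphic_derivI[OF fh] holomorphic_derivI[OF holomorphic_deriv[OF fh]] by auto
  have nz: "deriv f z \<noteq> 0" if "cmod z < 1" for z
    using conformal_bij_inverse(2)[OF f open_ball] that by simp
  define c where "c = deriv (deriv f) 0 / deriv f 0"
  define R where "R = (\<lambda>z. - ln (cmod (deriv f z)) - ln (1 - (cmod z)\<^sup>2))"
  \<comment> \<open>\<open>robin_eq\<close> concerns the image of 0 only; replacing \<open>f\<close>
    by \<open>f \<circ> disc_aut z\<close> reaches every other point.\<close>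
  have R: "robin D (f z) = R z" if "cmod z < 1" for z
  proof -
    have comp: "conformal_bij (f \<circ> disc_aut z) (ball 0 1) D"
      by (rule conformal_bij_compose[OF conformal_bij_disc_aut[OF that] f])
    have pos: "1 - (cmod z)\<^sup>2 > 0"
      using that by (simp add: abs_square_less_1)
    have "cmod (deriv (f \<circ> disc_aut z) 0) = cmod (deriv f z) * (1 - (cmod z)\<^sup>2)"
      using compose_disc_aut_derivs(1)[OF fh that] pos
      by (simp only: norm_mult norm_of_real)
    then show ?thesis
      using robin_eq[OF comp] pos nz[OF that] by (simp add: R_def ln_mult)
  qed
  have dR: "(R has_derivative (\<lambda>h. - Re (c * h))) (at 0)"
  proof -
    have "(deriv f has_derivative (\<lambda>h. deriv (deriv f) 0 * h)) (at 0)"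
      using f''[of 0] by (simp add: has_field_derivative_def)
    from has_derivative_compose[OF this has_derivative_norm] nz[of 0]
    have "((\<lambda>z. cmod (deriv f z)) has_derivative (\<lambda>h. (deriv (deriv f) 0 * h) \<bullet> sgn (deriv f 0))) (at 0)"
      by simp
    then have "((\<lambda>z. ln (cmod (deriv f z))) has_derivative (\<lambda>h. (deriv (deriv f) 0 * h) \<bullet> sgn (deriv f 0) / cmod (deriv f 0))) (at 0)" (is "?L")
      using nz[of 0] by (auto intro!: derivative_eq_intros simp: divide_inverse)
    have "a \<bullet> sgn b / cmod b = Re (a / b)" for a b :: complex
    proof -
      have "Re (a / b) = (a \<bullet> b) / (cmod b)\<^sup>2"
        by (simp add: Re_divide inner_complex_def cmod_power2)
      then show ?thesis
        by (simp add: sgn_div_norm power2_eq_square field_simps)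
    qed
    then have "(deriv (deriv f) 0 * h) \<bullet> sgn (deriv f 0) / cmod (deriv f 0) = Re (c * h)" for h
      by (simp only: c_def times_divide_eq_left)
    with \<open>?L\<close> have "((\<lambda>z. ln (cmod (deriv f z))) has_derivative (\<lambda>h. Re (c * h))) (at 0)"
      by (simp only:)
    moreover have "((\<lambda>z. ln (1 - (cmod z)\<^sup>2)) has_derivative (\<lambda>h. 0)) (at (0::complex))"
      unfolding power2_norm_eq_inner
      by (auto intro!: derivative_eq_intros)
    ultimately have "(R has_derivative (\<lambda>h. - Re (c * h) - 0)) (at 0)"
      unfolding R_def by (intro has_derivative_diff has_derivative_minus)
    then show ?thesis
      by simp
  qed
  have g0: "g (f 0) = 0"
    using g(2)[of 0] by simp
  have f0: "f 0 \<in> D"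
    using fD[of 0] by simp
  show ?thesis
  proof
    assume "critical_point (robin D) (f 0)"
    moreover have "(f has_derivative (\<lambda>h. deriv f 0 * h)) (at 0)"
      using f'[of 0] by (simp add: has_field_derivative_def)
    ultimately have "(robin D \<circ> f has_derivative (\<lambda>h. 0) \<circ> (\<lambda>h. deriv f 0 * h)) (at 0)"
      unfolding critical_point_def by (intro diff_chain_at)
    then have "(R has_derivative (\<lambda>h. 0) \<circ> (\<lambda>h. deriv f 0 * h)) (at 0)"
      by (rule has_derivative_transform_within_open[where s = "ball 0 1"]) (use R in auto)
    from has_derivative_unique[OF dR this] have "Re (c * h) = 0" for h
      by (simp add: fun_eq_iff)
    \<comment> \<open>With \<open>h = cnj c\<close> the real part becomes
      \<open>(cmod c)^2\<close>.\<close>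
    from this[of "cnj c"] have "c = 0"
      by (simp add: complex_eq_iff flip: power2_eq_square)
    then show "deriv (deriv f) 0 = 0"
      using nz[of 0] by (simp add: c_def)
  next
    assume "deriv (deriv f) 0 = 0"
    then have "(R has_derivative (\<lambda>h. 0)) (at (g (f 0)))"
      using dR by (simp add: c_def g0)
    moreover have "(g has_derivative (\<lambda>h. deriv g (f 0) * h)) (at (f 0))"
      using g(1) holomorphic_derivI[OF _ \<open>open D\<close> f0] f0
      by (auto simp: conformal_bij_def has_field_derivative_def)
    ultimately have "(R \<circ> g has_derivative (\<lambda>h. 0) \<circ> (\<lambda>h. deriv g (f 0) * h)) (at (f 0))"
      by (intro diff_chain_at)
    then have "(robin D has_derivative (\<lambda>h. 0) \<circ> (\<lambda>h. deriv g (f 0) * h)) (at (f 0))"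
    proof (rule has_derivative_transform_within_open[where s = D])
      fix x assume "x \<in> D"
      then show "(R \<circ> g) x = robin D x"
        using R[of "g x"] conformal_bij_memD[OF g(1)] g(3)[of x] by simp
    qed (use f0 \<open>open D\<close> in auto)
    then show "critical_point (robin D) (f 0)"
      by (simp add: critical_point_def o_def)
  qed
qed

text \<open>The negated equation says that \<open>f w1\<close> is critical. It is the equality case of the Schwarz lemma
  for \<open>Q / (Q + 2)\<close> with \<open>Q = w f'' / f'\<close>, a self-map of the disc because \<open>Re Q > - 1\<close>.\<close>

lemma no_second_critical_point:
  assumes f: "conformal_bij f (ball 0 1) D" and "convex D" "bounded D"
    and crit0: "deriv (deriv f) 0 = 0"
    and w1: "cmod w1 < 1" "w1 \<noteq> 0"
  shows "deriv (deriv f) w1 * (1 - (cmod w1)\<^sup>2) \<noteq> 2 * cnj w1 * deriv f w1"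
proof
  assume crit1: "deriv (deriv f) w1 * (1 - (cmod w1)\<^sup>2) = 2 * cnj w1 * deriv f w1"
  have fh: "f holomorphic_on ball 0 1" and fD: "\<And>z. cmod z < 1 \<Longrightarrow> f z \<in> D"
    using f conformal_bij_memD[OF f] by (auto simp: conformal_bij_def)
  have f': "(f has_field_derivative deriv f z) (at z)" 
    and f'': "(deriv f has_field_derivative deriv (deriv f) z) (at z)" if "cmod z < 1" for z
    using that holomorphic_derivI[OF fh] holomorphic_derivI[OF holomorphic_deriv[OF fh]] by auto
  have nz: "deriv f z \<noteq> 0" if "cmod z < 1" for z
    using conformal_bij_inverse(2)[OF f open_ball] that by simp
  define Q where "Q = (\<lambda>w. w * deriv (deriv f) w / deriv f w)"
  \<comment> \<open>The bound on second derivatives with base point moved to \<open>w\<close>,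
    divided by \<open>deriv f w\<close> and multiplied by \<open>w\<close>, which turns
    \<open>cnj w\<close> into the real number \<open>(cmod w)^2\<close>.\<close>
  have Qbound: "cmod (Q w * of_real (1 - (cmod w)\<^sup>2) - 2 * of_real ((cmod w)\<^sup>2)) \<le> 2 * cmod w" if w: "cmod w < 1" for w
  proof -
    define r where "r = complex_of_real (1 - (cmod w)\<^sup>2)"
    have "r \<noteq> 0"
      unfolding r_def of_real_eq_0_iff using w abs_square_less_1[of "cmod w"] by simp
    have comp: "conformal_bij (f \<circ> disc_aut w) (ball 0 1) D"
      by (rule conformal_bij_compose[OF conformal_bij_disc_aut[OF w] f])
    have "cmod (deriv (deriv f) w * r\<^sup>2 - 2 * cnj w * r * deriv f w) \<le> 2 * cmod (deriv f w * r)"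
      using norm_second_deriv_bound_convex[OF comp \<open>convex D\<close>] compose_disc_aut_derivs[OF fh w]
      by (simp add: r_def)
    also have "deriv (deriv f) w * r\<^sup>2 - 2 * cnj w * r * deriv f w
        = (deriv f w * r) * (deriv (deriv f) w / deriv f w * r - 2 * cnj w)"
      using nz[OF w] by (simp add: field_simps power2_eq_square)
    finally have le: "cmod (deriv (deriv f) w / deriv f w * r - 2 * cnj w) \<le> 2"
      using nz[OF w] \<open>r \<noteq> 0\<close> by (simp add: norm_mult)
    have "Q w * r - 2 * of_real ((cmod w)\<^sup>2) = w * (deriv (deriv f) w / deriv f w * r - 2 * cnj w)"
      unfolding Q_def complex_norm_square by (simp add: algebra_simps)
    then show ?thesis
      using mult_left_mono[OF le, of "cmod w"] by (simp add: norm_mult r_def mult.commute)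
  qed
  \<comment> \<open>In effect \<open>Re (Q w) \<ge> - 2 * r / (1 + r)\<close>, which exceeds -1 for
    \<open>r < 1\<close>. This is the classical analytic property Re (1 + w f''/f') > 0 of convex
    maps.\<close>
  have ReQ: "Re (Q w) > - 1" if w: "cmod w < 1" for w
  proof -
    define r where "r = cmod w"
    have r: "0 \<le> r" "r < 1"
      using w by (auto simp: r_def)
    have "\<bar>Re (Q w * of_real (1 - (cmod w)\<^sup>2) - 2 * of_real ((cmod w)\<^sup>2))\<bar> \<le> 2 * r"
      using Qbound[OF w] abs_Re_le_cmod order_trans unfolding r_def by blast
    moreover have "Re (Q w * of_real (1 - (cmod w)\<^sup>2) - 2 * of_real ((cmod w)\<^sup>2)) = Re (Q w) * (1 - r\<^sup>2) - 2 * r\<^sup>2"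
      unfolding r_def by (simp only: minus_complex.sel Re_complex_of_real times_complex.sel
        Im_complex_of_real) simp
    ultimately have "Re (Q w) * (1 - r\<^sup>2) \<ge> 2 * r\<^sup>2 - 2 * r"
      by linarith
    moreover have "2 * r\<^sup>2 - 2 * r > - (1 - r\<^sup>2)"
    proof -
      have "(1 - r)\<^sup>2 > 0"
        using r by simp
      then show ?thesis
        by (simp add: power2_eq_square algebra_simps)
    qed
    ultimately have "(Re (Q w) + 1) * (1 - r\<^sup>2) > 0"
      by (simp add: algebra_simps)
    moreover have "1 - r\<^sup>2 > 0"
      using r by (simp add: abs_square_less_1)
    ultimately show ?thesis
      by (simp add: zero_less_mult_iff)
  qed
  have Q2: "Q w + 2 \<noteq> 0" if "cmod w < 1" for w
    using ReQ[OF that] by (auto simp: complex_eq_iff)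
  have Qh: "Q holomorphic_on ball 0 1"
    unfolding Q_def using nz by (intro holomorphic_intros fh) auto
  \<comment> \<open>The Cayley transform of \<open>1 + Q\<close>, taking the half-plane
    \<open>Re Q > - 1\<close> into the disc and 0 to 0.\<close>
  define \<omega> where "\<omega> = (\<lambda>w. Q w / (Q w + 2))"
  have \<omega>h: "\<omega> holomorphic_on ball 0 1"
    unfolding \<omega>_def using Q2 by (intro holomorphic_intros Qh) auto
  have \<omega>lt: "cmod (\<omega> w) < 1" if "cmod w < 1" for w
  proof -
    have "(cmod (Q w))\<^sup>2 < (cmod (Q w + 2))\<^sup>2"
      using ReQ[OF that] by (simp only: cmod_power2) (simp add: power2_eq_square algebra_simps)
    then have "cmod (Q w) < cmod (Q w + 2)"
      by (rule power2_less_imp_less) simp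
    then show ?thesis
      using Q2[OF that] by (simp add: \<omega>_def norm_divide)
  qed
  have \<omega>0: "\<omega> 0 = 0"
    by (simp add: \<omega>_def Q_def)
  \<comment> \<open>The zero is at least double: one factor \<open>w\<close> is explicit in
    \<open>Q\<close>, another comes from \<open>crit0\<close>.\<close>
  have \<omega>'0: "deriv \<omega> 0 = 0"
  proof -
    define G where "G = (\<lambda>w. deriv (deriv f) w / deriv f w / (Q w + 2))"
    have "G holomorphic_on ball 0 1"
      unfolding G_def using nz Q2 by (intro holomorphic_intros fh Qh) auto
    then have "(G has_field_derivative deriv G 0) (at 0)"
      using holomorphic_derivI[of G "ball 0 1" 0] by simp
    from DERIV_mult[OF DERIV_ident this]
    have "((\<lambda>w. w * G w) has_field_derivative G 0) (at 0)"
      by simp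
    moreover have "G 0 = 0"
      by (simp add: G_def crit0)
    moreover have "\<omega> = (\<lambda>w. w * G w)"
      by (simp add: \<omega>_def G_def Q_def)
    ultimately show ?thesis
      by (simp add: DERIV_imp_deriv)
  qed
  obtain k where k: "k holomorphic_on ball 0 1" "\<And>z. cmod z < 1 \<Longrightarrow> \<omega> z = z\<^sup>2 * k z"
    "\<And>z. cmod z < 1 \<Longrightarrow> cmod (k z) \<le> 1"
    using Schwarz_second_order[OF \<omega>h \<omega>0 \<omega>'0 \<omega>lt] by auto
  \<comment> \<open>With \<open>t = (cmod w1)^2\<close>, the equation \<open>crit1\<close> says
    \<open>Q w1 = 2 * t / (1 - t)\<close>, so \<open>\<omega> w1 = t\<close>. The second-order
    Schwarz bound is attained at an interior point, and the maximum principle makes \<open>k\<close>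
    constant.\<close>
  have k1: "cmod (k w1) = 1"
  proof -
    define r where "r = complex_of_real (1 - (cmod w1)\<^sup>2)"
    have "r \<noteq> 0"
      unfolding r_def of_real_eq_0_iff using w1 abs_square_less_1[of "cmod w1"] by simp
    have "Q w1 * r = w1 * (deriv (deriv f) w1 * r) / deriv f w1"
      by (simp add: Q_def)
    also have "\<dots> = 2 * w1 * cnj w1"
      unfolding r_def crit1 using nz[OF w1(1)] by simp
    also have "\<dots> = 2 * (1 - r)"
      unfolding r_def using complex_norm_square[of w1] by simp
    finally have "Q w1 = 2 * (1 - r) / r"
      using \<open>r \<noteq> 0\<close> by (simp add: field_simps)
    moreover have "2 * (1 - r) / r + 2 = 2 / r"
      using \<open>r \<noteq> 0\<close> by (simp add: field_simps)
    ultimately have "\<omega> w1 = 1 - r"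
      unfolding \<omega>_def using \<open>r \<noteq> 0\<close> by simp
    then have "w1\<^sup>2 * k w1 = of_real ((cmod w1)\<^sup>2)"
      using k(2)[OF w1(1)] by (simp add: r_def)
    then have "cmod (w1\<^sup>2 * k w1) = (cmod w1)\<^sup>2"
      by (simp only: norm_of_real) simp
    then show ?thesis
      using w1 by (simp add: norm_mult norm_power)
  qed
  obtain c where c: "\<And>z. cmod z < 1 \<Longrightarrow> k z = c"
  proof -
    have "k constant_on ball 0 1"
      by (rule maximum_modulus_principle[OF k(1), of "ball 0 1" w1]) (use k1 k(3) w1 in auto)
    then show thesis
      using that by (auto simp: constant_on_def)
  qed
  have c1: "cmod c = 1"
    using k1 c[OF w1(1)] by simp
  have ode: "deriv (deriv f) z * (1 - c * z\<^sup>2) = 2 * c * z * deriv f z" if z: "cmod z < 1" for z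
  proof (cases "z = 0")
    case False
    have "Q z = c * z\<^sup>2 * (Q z + 2)"
      using k(2)[OF z] c[OF z] Q2[OF z] by (simp add: \<omega>_def field_simps)
    then have "Q z * deriv f z = c * z\<^sup>2 * (Q z * deriv f z + 2 * deriv f z)"
      by (metis mult.assoc distrib_right)
    then have "z * deriv (deriv f) z = c * z\<^sup>2 * (z * deriv (deriv f) z + 2 * deriv f z)"
      using nz[OF z] by (simp add: Q_def)
    then have "z * (deriv (deriv f) z * (1 - c * z\<^sup>2)) = z * (2 * c * z * deriv f z)"
      by (simp add: algebra_simps power2_eq_square)
    then show ?thesis
      using False by simp
  qed (simp add: crit0)
  \<comment> \<open>\<open>1 - c * z^2\<close> is an integrating factor of \<open>ode\<close>: the
    derivative of the product vanishes.\<close>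
  have f'_eq: "deriv f z * (1 - c * z\<^sup>2) = deriv f 0" if z: "cmod z < 1" for z
  proof -
    have "(\<lambda>z. deriv f z * (1 - c * z\<^sup>2)) constant_on ball 0 1"
    proof (rule has_field_derivative_0_imp_constant_on)
      fix x :: complex assume x: "x \<in> ball 0 1"
      have "deriv (deriv f) x * (1 - c * x\<^sup>2) + deriv f x * (- (c * (2 * x))) = 0"
        using ode[of x] x by (simp add: algebra_simps)
      then show "((\<lambda>z. deriv f z * (1 - c * z\<^sup>2)) has_field_derivative 0) (at x)"
        using x by (auto intro!: derivative_eq_intros f'' simp: mult_ac)
    qed auto
    then obtain C where "\<And>z. cmod z < 1 \<Longrightarrow> deriv f z * (1 - c * z\<^sup>2) = C"
      by (auto simp: constant_on_def)
    from this[OF z] this[of 0] show ?thesis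
      by simp
  qed
  \<comment> \<open>The direction in which \<open>1 - c * z^2\<close> has a zero on the unit circle:
    at \<open>z = s * e\<close> it equals \<open>1 - s^2\<close>. After division by
    \<open>e * deriv f 0\<close> the derivative of \<open>f\<close> along this ray is
    \<open>1 / (1 - s^2)\<close>, so \<open>u\<close> below is artanh up to a constant.\<close>
  define e where "e = inverse (csqrt c)"
  have e: "c * e\<^sup>2 = 1" "cmod e = 1"
  proof -
    have "c \<noteq> 0"
      using c1 by auto
    then show "c * e\<^sup>2 = 1" "cmod e = 1"
      using c1 by (auto simp: e_def power_inverse norm_inverse)
  qed
  define u where "u = (\<lambda>s. Re (f (of_real s * e) / (e * deriv f 0)))"
  have u': "(u has_real_derivative 1 / (1 - s\<^sup>2)) (at s)" if s: "0 \<le> s" "s < 1" for s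
  proof -
    have se: "cmod (of_real s * e) < 1"
      using s e by (simp add: norm_mult)
    have "((\<lambda>s. of_real s * e) has_vector_derivative e) (at s)"
      by (auto intro!: derivative_eq_intros)
    from field_vector_diff_chain_at[OF this f'[OF se]]
    have "((\<lambda>s. f (of_real s * e)) has_vector_derivative e * deriv f (of_real s * e)) (at s)"
      by (simp add: o_def)
    then have "((\<lambda>s. f (of_real s * e) / (e * deriv f 0)) has_vector_derivative
        e * deriv f (of_real s * e) / (e * deriv f 0)) (at s)"
      by (rule has_vector_derivative_divide)
    moreover have "e * deriv f (of_real s * e) / (e * deriv f 0) = of_real (1 / (1 - s\<^sup>2))"
    proof -
      have "c * (of_real s * e)\<^sup>2 = of_real (s\<^sup>2) * (c * e\<^sup>2)"
        by (simp add: power_mult_distrib)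
      then have "deriv f (of_real s * e) * of_real (1 - s\<^sup>2) = deriv f 0"
        using f'_eq[OF se] e(1) by simp
      moreover have "1 - s\<^sup>2 \<noteq> 0"
        using s abs_square_less_1[of s] by simp
      ultimately show ?thesis
        using nz[of 0] nz[OF se] e(2)
        by (auto simp: divide_simps simp del: of_real_diff of_real_power)
    qed
    ultimately show ?thesis
      unfolding u_def has_real_derivative_iff_has_vector_derivative
      by (auto dest: bounded_linear.has_vector_derivative[OF bounded_linear_Re])
  qed
  obtain B where B: "\<And>z. z \<in> D \<Longrightarrow> cmod z \<le> B"
    using \<open>bounded D\<close> by (auto simp: bounded_iff)
  have ub: "\<bar>u s\<bar> \<le> B / cmod (deriv f 0)" if "0 \<le> s" "s < 1" for s
  proof -
    have "\<bar>u s\<bar> \<le> cmod (f (of_real s * e)) / cmod (deriv f 0)"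
      unfolding u_def using abs_Re_le_cmod[of "f (of_real s * e) / (e * deriv f 0)"] e
      by (simp add: norm_divide norm_mult)
    also have "\<dots> \<le> B / cmod (deriv f 0)"
      using that e by (intro divide_right_mono B fD) (auto simp: norm_mult)
    finally show ?thesis .
  qed
  have ug: "u s - u 0 \<ge> - ln (1 - s) / 2" if s: "0 \<le> s" "s < 1" for s
  proof -
    have "u 0 + ln (1 - 0) / 2 \<le> u s + ln (1 - s) / 2"
    proof (rule DERIV_nonneg_imp_nondecreasing[OF s(1)])
      fix x assume x: "0 \<le> x" "x \<le> s"
      have "((\<lambda>s. ln (1 - s) / 2) has_real_derivative - (1 / (1 - x) / 2)) (at x)"
        using x s by (auto intro!: derivative_eq_intros simp: divide_simps)
      from DERIV_add[OF u' this] x s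
      have "((\<lambda>s. u s + ln (1 - s) / 2) has_real_derivative 1 / (1 - x\<^sup>2) - 1 / (1 - x) / 2) (at x)"
        by simp
      moreover have "1 / (1 - x\<^sup>2) - 1 / (1 - x) / 2 = 1 / (2 * (1 + x))"
      proof -
        have "1 - x\<^sup>2 = (1 - x) * (1 + x)"
          by (simp add: power2_eq_square algebra_simps)
        moreover have "1 - x \<noteq> 0" "1 + x \<noteq> 0"
          using x s by auto
        ultimately show ?thesis
          by (simp add: divide_simps) (simp add: algebra_simps)
      qed
      ultimately show "\<exists>y. ((\<lambda>s. u s + ln (1 - s) / 2) has_real_derivative y) (at x) \<and> 0 \<le> y"
        using x by (intro exI[of _ "1 / (2 * (1 + x))"]) auto
    qed
    then show ?thesis
      by simp
  qed
  have bd: "- ln (1 - s) / 2 \<le> 2 * (B / cmod (deriv f 0))" if "0 \<le> s" "s < 1" for s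
    using ub[OF that] ub[of 0] ug[OF that] by linarith
  define M where "M = 2 * (B / cmod (deriv f 0))"
  have "M \<ge> 0"
    using bd[of 0] by (simp add: M_def)
  \<comment> \<open>The value of \<open>s\<close> is chosen so that
    \<open>- ln (1 - s) / 2 = M + 1\<close>.\<close>
  then have "- ln (1 - (1 - exp (- 2 * (M + 1)))) / 2 \<le> M"
    unfolding M_def by (intro bd) auto
  then show False
    by simp
qed

section \<open>Centrally symmetric domains\<close>

lemma exists_conformal_bij_disc:
  assumes "open D" "convex D" "bounded D" "c \<in> D"
  obtains F where "conformal_bij F (ball 0 1) D" "F 0 = c"
proof -
  have "simply_connected D"
    using \<open>convex D\<close> by (rule convex_imp_simply_connected)
  moreover have "D \<noteq> UNIV"
    using \<open>bounded D\<close> not_bounded_UNIV by auto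
  moreover have "D \<noteq> {}"
    using \<open>c \<in> D\<close> by auto
  ultimately obtain f g where fg: "f holomorphic_on D" "g holomorphic_on ball 0 1"
      "\<forall>z\<in>D. f z \<in> ball 0 1 \<and> g (f z) = z" "\<forall>z\<in>ball 0 1. g z \<in> D \<and> f (g z) = z"
    using Riemann_mapping_theorem[of D] \<open>open D\<close> by auto
  have "bij_betw g (ball 0 1) D"
    by (rule bij_betw_byWitness[where f' = f]) (use fg in auto)
  with fg have g: "conformal_bij g (ball 0 1) D"
    by (simp add: conformal_bij_def)
  have "cmod (f c) < 1"
    using fg(3) \<open>c \<in> D\<close> by simp
  from conformal_bij_compose[OF conformal_bij_disc_aut[OF this] g] show thesis
    by (rule that) (use fg(3) \<open>c \<in> D\<close> in simp)
qed

lemma conformal_bij_affine: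
  assumes "v \<noteq> 0"
  shows "conformal_bij (\<lambda>z. c + v * z) E ((\<lambda>z. c + v * z) ` E)"
  using assms by (auto simp: conformal_bij_def bij_betw_def inj_on_def intro!: holomorphic_intros)

lemma higher_deriv_affine:
  assumes "F holomorphic_on S" "open S" "z \<in> S" "n > 0"
  shows "(deriv ^^ n) (\<lambda>w. c + v * F w) z = v * (deriv ^^ n) F z"
  using assms by (simp add: higher_deriv_add[OF _ _ assms(2)] higher_deriv_cmult holomorphic_intros)

lemma higher_deriv_rotation:
  assumes f: "f holomorphic_on ball 0 1" and "cmod u = 1"
    and g: "\<And>z. cmod z < 1 \<Longrightarrow> g z = f (u * z)"
  shows "(deriv ^^ n) g 0 = u ^ n * (deriv ^^ n) f 0"
proof -
  have "(\<lambda>z. u * z) ` ball 0 1 \<subseteq> ball 0 1"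
    using \<open>cmod u = 1\<close> by (auto simp: norm_mult)
  from holomorphic_on_compose_gen[OF _ f this]
  have fu: "(\<lambda>z. f (u * z)) holomorphic_on ball 0 1"
    by (simp add: o_def holomorphic_intros)
  then have "g holomorphic_on ball 0 1"
    by (rule holomorphic_transform) (simp add: g)
  from higher_deriv_transform_within_open[OF this fu, of 0 n]
  have "(deriv ^^ n) g 0 = (deriv ^^ n) (\<lambda>z. f (u * z)) 0"
    using g by simp
  then show ?thesis
    using higher_deriv_compose_linear[OF f, of "ball 0 1" 0 u n] \<open>cmod u = 1\<close> by (simp add: norm_mult)
qed

text \<open>The map \<open>g\<close> sending z to 2 c - f(-z) is a second Riemann map with centre
  \<open>c\<close>, hence a rotation of \<open>f\<close>. Comparing first derivatives gives
  \<open>u = 1\<close>, and then second derivatives give f''(0) = - f''(0).\<close>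

lemma robin_critical_point_symmetric:
  assumes "open D" "convex D" "bounded D" "c \<in> D" and sym: "\<And>z. z \<in> D \<Longrightarrow> 2 * c - z \<in> D"
  shows "robin_critical_point D = c"
proof -
  obtain f where f: "conformal_bij f (ball 0 1) D" and f0: "f 0 = c"
    using exists_conformal_bij_disc[OF assms(1-4)] by blast
  have fh: "f holomorphic_on ball 0 1"
    using f by (simp add: conformal_bij_def)
  have nz: "deriv f 0 \<noteq> 0"
    using conformal_bij_inverse(2)[OF f open_ball] by simp
  define g where "g = (\<lambda>z. 2 * c + (- 1) * f ((- 1) * z))"
  have "(\<lambda>z. 2 * c + (- 1) * z) ` D = D"
  proof
    show "D \<subseteq> (\<lambda>z. 2 * c + (- 1) * z) ` D"
    proof
      fix x assume "x \<in> D"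
      from sym[OF this] show "x \<in> (\<lambda>z. 2 * c + (- 1) * z) ` D"
        by (rule rev_image_eqI) simp
    qed
  qed (use sym in auto)
  then have "conformal_bij (\<lambda>z. 2 * c + (- 1) * z) D D"
    using conformal_bij_affine[of "- 1" "2 * c" D] by simp
  from conformal_bij_compose[OF conformal_bij_compose[OF conformal_bij_mult_unit[of "- 1"] f] this]
  have g: "conformal_bij g (ball 0 1) D"
    by (simp add: g_def o_def)
  obtain u where u: "cmod u = 1" "\<And>z. cmod z < 1 \<Longrightarrow> g z = f (u * z)"
    using conformal_bij_unique_rotation[OF f g] f0 by (auto simp: g_def)
  have gd: "(deriv ^^ n) g 0 = - ((- 1) ^ n * (deriv ^^ n) f 0)" if "n > 0" for n
  proof -
    define f2 where "f2 = (\<lambda>z. f ((- 1) * z))"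
    have "(\<lambda>z. (- 1) * z) ` ball 0 1 \<subseteq> ball (0 :: complex) 1"
      by auto
    from holomorphic_on_compose_gen[OF _ fh this] have "f2 holomorphic_on ball 0 1"
      by (simp add: o_def f2_def holomorphic_intros)
    from higher_deriv_affine[OF this, of 0 n "2 * c" "- 1"]
    have "(deriv ^^ n) g 0 = - (deriv ^^ n) f2 0"
      using that by (simp add: g_def f2_def)
    also have "(deriv ^^ n) f2 0 = (- 1) ^ n * (deriv ^^ n) f 0"
      by (rule higher_deriv_rotation[OF fh]) (auto simp: f2_def)
    finally show ?thesis .
  qed
  have gu: "(deriv ^^ n) g 0 = u ^ n * (deriv ^^ n) f 0" for n
    by (rule higher_deriv_rotation[OF fh u])
  have "u = 1"
    using gd[of 1] gu[of 1] nz by simp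
  then have "deriv (deriv f) 0 = 0"
    using gd[of 2] gu[of 2] by (simp add: numeral_2_eq_2 equal_neg_zero)
  then have crit: "critical_point (robin D) c"
    using critical_point_robin_iff[OF f] f0 by simp
  have uniq: "\<xi> = c" if \<xi>: "\<xi> \<in> D" "critical_point (robin D) \<xi>" for \<xi>
  proof -
    obtain w where w: "cmod w < 1" "f w = \<xi>"
      using f \<xi>(1) by (auto simp: conformal_bij_def bij_betw_def)
    have comp: "conformal_bij (f \<circ> disc_aut w) (ball 0 1) D"
      by (rule conformal_bij_compose[OF conformal_bij_disc_aut[OF w(1)] f])
    define r where "r = complex_of_real (1 - (cmod w)\<^sup>2)"
    have "r \<noteq> 0"
      unfolding r_def of_real_eq_0_iff using w abs_square_less_1[of "cmod w"] by simp
    have "deriv (deriv (f \<circ> disc_aut w)) 0 = 0"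
      using critical_point_robin_iff[OF comp] \<xi>(2) w(2) by simp
    \<comment> \<open>The moved second derivative splits off a factor \<open>r\<close>; the rest is
      the equation that is impossible unless \<open>w = 0\<close>.\<close>
    then have "r * (deriv (deriv f) w * r - 2 * cnj w * deriv f w) = 0"
      unfolding compose_disc_aut_derivs(2)[OF fh w(1)] r_def by (simp add: algebra_simps power2_eq_square)
    then have "deriv (deriv f) w * r = 2 * cnj w * deriv f w"
      using \<open>r \<noteq> 0\<close> by simp
    then have "w = 0"
      using no_second_critical_point[OF f assms(2,3) \<open>deriv (deriv f) 0 = 0\<close> w(1)] by (auto simp: r_def)
    then show ?thesis
      using w(2) f0 by simp
  qed
  show ?thesis
    unfolding robin_critical_point_def
    by (rule the_equality, rule conjI[OF \<open>c \<in> D\<close> crit]) (erule conjE, erule (1) uniq)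
qed

text \<open>The quotient F'''(0) / F'(0) is unchanged by the affine map, and a rotation of the disc
  multiplies it by a number of modulus 1. So the existential quantifier in \<open>ND\<close> may be
  tested on a single \<open>F\<close> for a normalized shape.\<close>

lemma ND_affine_iff:
  assumes E: "open E" "convex E" "bounded E" "0 \<in> E" and sym: "\<And>z. z \<in> E \<Longrightarrow> - z \<in> E"
    and F: "conformal_bij F (ball 0 1) E" "F 0 = 0"
    and "v \<noteq> 0" and D: "D = (\<lambda>z. c + v * z) ` E"
  shows "ND D \<longleftrightarrow> cmod ((deriv ^^ 3) F 0 / deriv F 0) \<notin> resonant_values"
proof -
  have Fh: "F holomorphic_on ball 0 1"
    using F by (simp add: conformal_bij_def)
  define F2 where "F2 = (\<lambda>z. c + v * F z)"
  have F2: "conformal_bij F2 (ball 0 1) D"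
    using conformal_bij_compose[OF F(1) conformal_bij_affine[OF \<open>v \<noteq> 0\<close>]] by (simp add: D F2_def o_def)
  have F2h: "F2 holomorphic_on ball 0 1"
    using F2 by (simp add: conformal_bij_def)
  have crit: "robin_critical_point D = c"
  proof (rule robin_critical_point_symmetric)
    show "open D"
      using conformal_bij_open_image[OF F2] by simp
    show "convex D"
    proof -
      have "convex ((\<lambda>x. c + x) ` ((*) v ` E))"
        by (intro convex_translation convex_linear_image E) (simp add: linear_times)
      then show ?thesis
        by (simp add: D image_image)
    qed
    show "bounded D"
    proof -
      have "bounded ((\<lambda>x. c + x) ` ((*) v ` E))"
        by (intro bounded_translation bounded_linear_image E) (simp add: bounded_linear_mult_right)
      then show ?thesis
        by (simp add: D image_image)
    qed
    show "c \<in> D"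
      using E(4) by (auto simp: D)
    show "2 * c - z \<in> D" if z: "z \<in> D" for z
    proof -
      obtain x where "x \<in> E" "z = c + v * x"
        using z by (auto simp: D)
      then show ?thesis
        using sym[of x] by (auto simp: D intro!: rev_image_eqI[of "- x"])
    qed
  qed
  have F2d: "(deriv ^^ 3) F2 0 / deriv F2 0 = (deriv ^^ 3) F 0 / deriv F 0"
    using higher_deriv_affine[OF Fh, of 0 3 c v] higher_deriv_affine[OF Fh, of 0 1 c v] \<open>v \<noteq> 0\<close>
    by (simp add: F2_def)
  have "cmod ((deriv ^^ 3) G 0 / deriv G 0) = cmod ((deriv ^^ 3) F 0 / deriv F 0)"
    if G: "conformal_bij G (ball 0 1) D" "G 0 = c" for G
  proof -
    obtain u where u: "cmod u = 1" "\<And>z. cmod z < 1 \<Longrightarrow> G z = F2 (u * z)"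
      using conformal_bij_unique_rotation[OF F2 G(1)] G(2) F(2) by (auto simp: F2_def)
    have gu: "(deriv ^^ n) G 0 = u ^ n * (deriv ^^ n) F2 0" for n
      by (rule higher_deriv_rotation[OF F2h u])
    have "cmod ((deriv ^^ 3) G 0 / deriv G 0) = cmod ((deriv ^^ 3) F2 0 / deriv F2 0)"
      using gu[of 3] gu[of 1] u(1) by (simp add: norm_mult norm_divide norm_power)
    with F2d show ?thesis
      by simp
  qed
  moreover have "F2 0 = c"
    using F(2) by (simp add: F2_def)
  ultimately show ?thesis
    unfolding ND_def crit using F2 by auto
qed

text \<open>Uniqueness up to rotation turns the symmetry into \<i> F(z) = F(\<i> z). Third
  derivatives then give \<i> F'''(0) = - \<i> F'''(0), so the quotient is 0, the resonant value for
  n = 1. This settles discs and squares without an explicit map.\<close>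

lemma ND_quarter_turn_symmetric:
  assumes E: "open E" "convex E" "bounded E" "0 \<in> E" and sym: "\<And>z. z \<in> E \<Longrightarrow> \<i> * z \<in> E"
    and "v \<noteq> 0" and D: "D = (\<lambda>z. c + v * z) ` E"
  shows "\<not> ND D"
proof -
  obtain F where F: "conformal_bij F (ball 0 1) E" "F 0 = 0"
    using exists_conformal_bij_disc[OF E] by blast
  have Fh: "F holomorphic_on ball 0 1"
    using F by (simp add: conformal_bij_def)
  have nz: "deriv F 0 \<noteq> 0"
    using conformal_bij_inverse(2)[OF F(1) open_ball] by simp
  have sym2: "- z \<in> E" if "z \<in> E" for z
    using sym[OF sym[OF that]] by simp
  have "(\<lambda>z. 0 + \<i> * z) ` E = E"
  proof
    show "E \<subseteq> (\<lambda>z. 0 + \<i> * z) ` E"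
    proof
      fix x assume "x \<in> E"
      from sym[OF sym2[OF this]] show "x \<in> (\<lambda>z. 0 + \<i> * z) ` E"
        by (rule rev_image_eqI) simp
    qed
  qed (use sym in auto)
  then have "conformal_bij (\<lambda>z. 0 + \<i> * z) E E"
    using conformal_bij_affine[of \<i> 0 E] by simp
  from conformal_bij_compose[OF F(1) this]
  have G: "conformal_bij (\<lambda>z. \<i> * F z) (ball 0 1) E"
    by (simp add: o_def)
  obtain u where u: "cmod u = 1" "\<And>z. cmod z < 1 \<Longrightarrow> \<i> * F z = F (u * z)"
    using conformal_bij_unique_rotation[OF F(1) G] F(2) by auto
  have gu: "\<i> * (deriv ^^ n) F 0 = u ^ n * (deriv ^^ n) F 0" for n
    using higher_deriv_rotation[OF Fh u, of n] higher_deriv_cmult[OF Fh, of 0 n \<i>] by simp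
  have "u = \<i>"
    using gu[of 1] nz by simp
  then have "(deriv ^^ 3) F 0 = 0"
    using gu[of 3] by (simp add: power3_eq_cube)
  moreover have "0 \<in> resonant_values"
    by (auto simp: resonant_values_def intro!: exI[of _ 1])
  ultimately show ?thesis
    using ND_affine_iff[OF E sym2 F \<open>v \<noteq> 0\<close> D] by simp
qed

section \<open>Riemann maps identified by the boundary modulus of their inverse\<close>

text \<open>Maximum modulus on closed discs with radius close to 1. The hypothesis bounds
  \<open>cmod z * cmod (p z)\<close> because \<open>p\<close> will be the quotient of
  \<open>P \<circ> F\<close> by \<open>z\<close>, or the inverse of that quotient, and near the
  circle it is \<open>P \<circ> F\<close> that is under control.\<close>

lemma norm_le_1_if_boundary_norm_le_1:
  assumes p: "p holomorphic_on ball 0 1"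
    and bd: "\<And>\<epsilon>. \<epsilon> > 0 \<Longrightarrow> \<exists>r<1. \<forall>z. r < cmod z \<and> cmod z < 1 \<longrightarrow> cmod z * cmod (p z) \<le> 1 + \<epsilon>"
    and z: "cmod z < 1"
  shows "cmod (p z) \<le> 1"
proof (rule field_le_epsilon)
  fix \<epsilon> :: real assume "\<epsilon> > 0"
  then obtain r where r: "r < 1" "\<And>z. r < cmod z \<Longrightarrow> cmod z < 1 \<Longrightarrow> cmod z * cmod (p z) \<le> 1 + \<epsilon>"
    using bd by blast
  show "cmod (p z) \<le> 1 + \<epsilon>"
  \<comment> \<open>On the circle of radius \<open>\<rho>\<close> only the bound
    \<open>(1 + \<epsilon>) / \<rho>\<close> is available; the slack \<open>t \<le> \<rho>\<close>
    absorbs the division.\<close>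
  proof (rule field_le_mult_one_interval)
    fix t :: real assume t: "0 < t" "t < 1"
    define \<rho> where "\<rho> = max t (max ((1 + r) / 2) (cmod z))"
    have "r < (1 + r) / 2"
      using r(1) by simp
    then have \<rho>: "t \<le> \<rho>" "r < \<rho>" "cmod z \<le> \<rho>" "\<rho> < 1" "\<rho> > 0"
      unfolding \<rho>_def using t r(1) z by (auto simp: less_max_iff_disj)
    have "cmod (p z) \<le> (1 + \<epsilon>) / \<rho>"
    proof (rule maximum_modulus_frontier[of p "cball 0 \<rho>"])
      show "p holomorphic_on interior (cball 0 \<rho>)" "continuous_on (closure (cball 0 \<rho>)) p"
        using \<rho> by (auto intro!: holomorphic_on_imp_continuous_on holomorphic_on_subset[OF p])
      show "cmod (p w) \<le> (1 + \<epsilon>) / \<rho>" if "w \<in> frontier (cball 0 \<rho>)" for w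
        using r(2)[of w] that \<rho> by (simp add: field_simps)
    qed (use \<rho> in auto)
    then have "\<rho> * cmod (p z) \<le> 1 + \<epsilon>"
      using \<rho> by (simp add: field_simps)
    moreover have "t * cmod (p z) \<le> \<rho> * cmod (p z)"
      using \<rho> by (intro mult_right_mono) auto
    ultimately show "t * cmod (p z) \<le> 1 + \<epsilon>"
      by linarith
  qed
qed

text \<open>No boundary extension of \<open>F\<close> is involved. The points of \<open>K\<close>
  where \<open>cmod (P z)\<close> differs from 1 by at least \<open>\<epsilon>\<close> form a
  compact subset of \<open>E\<close>, whose preimage stays away from the unit circle; hence the
  modulus of \<open>P \<circ> F\<close> tends to 1 uniformly. The quotient \<open>k\<close> by
  \<open>z\<close> has no zeros, so the maximum principle for \<open>k\<close> and for its inverse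
  gives modulus 1 throughout.\<close>

lemma inverse_conformal_from_boundary_modulus:
  assumes F: "conformal_bij F (ball 0 1) E" "F 0 = 0"
    and P: "P holomorphic_on E" "P 0 = 0" "deriv P 0 \<noteq> 0" "\<And>z. z \<in> E \<Longrightarrow> z \<noteq> 0 \<Longrightarrow> P z \<noteq> 0"
    and K: "compact K" "E \<subseteq> K" "continuous_on K P" "\<And>z. z \<in> K - E \<Longrightarrow> cmod (P z) = 1"
  obtains c where "cmod c = 1" "\<And>z. cmod z < 1 \<Longrightarrow> P (F z) = c * z"
proof -
  have "open E"
    using conformal_bij_open_image[OF F(1)] by simp
  have FE: "F z \<in> E" if "cmod z < 1" for z
    using conformal_bij_memD[OF F(1)] that by simp
  have Fh: "F holomorphic_on ball 0 1"
    using F by (simp add: conformal_bij_def)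
  obtain g where g: "conformal_bij g E (ball 0 1)" "\<And>z. z \<in> ball 0 1 \<Longrightarrow> g (F z) = z"
    using conformal_bij_inverse(1)[OF F(1) open_ball] by blast
  have gc: "continuous_on E g"
    using g(1) by (simp add: conformal_bij_def holomorphic_on_imp_continuous_on)
  have PFh: "P \<circ> F holomorphic_on ball 0 1"
    using FE by (intro holomorphic_on_compose_gen[OF Fh P(1)]) auto
  have PF0: "(P \<circ> F) 0 = 0"
    by (simp add: F P)
  obtain k where k: "k holomorphic_on ball 0 1" "\<And>z. cmod z < 1 \<Longrightarrow> (P \<circ> F) z = z * k z"
    "deriv (P \<circ> F) 0 = k 0"
    using Schwarz3[OF PFh PF0] by blast
  have knz: "k z \<noteq> 0" if z: "cmod z < 1" for z
  proof (cases "z = 0")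
    case True
    have "0 \<in> E"
      using FE[of 0] F(2) by simp
    then have "(P \<circ> F has_field_derivative deriv P 0 * deriv F 0) (at 0)"
      by (intro DERIV_chain holomorphic_derivI[OF Fh])
        (auto simp: F intro!: holomorphic_derivI[OF P(1) \<open>open E\<close>])
    then have "k 0 = deriv P 0 * deriv F 0"
      using k(3) by (simp add: DERIV_imp_deriv)
    then show ?thesis
      using True P(3) conformal_bij_inverse(2)[OF F(1) open_ball, of 0] by simp
  next
    case False
    then have "F z \<noteq> 0"
      using g(2)[of z] g(2)[of 0] z F(2) by force
    then show ?thesis
      using P(4)[OF FE[OF z]] k(2)[OF z] by auto
  qed
  have lim: "\<exists>r<1. \<forall>z. r < cmod z \<and> cmod z < 1 \<longrightarrow> \<bar>cmod (P (F z)) - 1\<bar> < \<epsilon>" if \<epsilon>: "\<epsilon> > 0" for \<epsilon>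
  proof -
    define C where "C = {z \<in> K. \<epsilon> \<le> \<bar>cmod (P z) - 1\<bar>}"
    have "compact C"
    proof -
      have "continuous_on K (\<lambda>z. \<bar>cmod (P z) - 1\<bar>)"
        by (intro continuous_intros K)
      from continuous_closedin_preimage[OF this, of "{\<epsilon>..}"]
      have "closedin (top_of_set K) C"
        by (simp add: C_def vimage_def Int_def)
      then show ?thesis
        using K(1) by (rule closedin_compact[rotated])
    qed
    have "C \<subseteq> E"
    proof
      fix x assume "x \<in> C"
      then have "x \<in> K" "cmod (P x) \<noteq> 1"
        using \<epsilon> by (auto simp: C_def)
      then show "x \<in> E"
        using K(4)[of x] by blast
    qed
    have "compact (g ` C)"
      using \<open>compact C\<close> \<open>C \<subseteq> E\<close> gc by (meson compact_continuous_image continuous_on_subset)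
    have gC: "g ` C \<subseteq> ball 0 1"
      using \<open>C \<subseteq> E\<close> conformal_bij_memD[OF g(1)] by blast
    have "\<exists>r<1. \<forall>z\<in>g ` C. cmod z \<le> r"
    proof (cases "C = {}")
      case False
      then obtain m where "m \<in> g ` C" "\<And>z. z \<in> g ` C \<Longrightarrow> cmod z \<le> cmod m"
        using continuous_attains_sup[OF \<open>compact (g ` C)\<close>, of cmod] by (auto intro!: continuous_intros)
      then show ?thesis
        using gC by (intro exI[of _ "cmod m"]) auto
    qed (auto intro: exI[of _ 0])
    then obtain r where r: "r < 1" "\<And>z. z \<in> g ` C \<Longrightarrow> cmod z \<le> r"
      by blast
    have "\<bar>cmod (P (F z)) - 1\<bar> < \<epsilon>" if "r < cmod z" "cmod z < 1" for z
    proof (rule ccontr)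
      assume "\<not> \<bar>cmod (P (F z)) - 1\<bar> < \<epsilon>"
      then have "F z \<in> C"
        using FE[OF that(2)] K(2) by (auto simp: C_def)
      then have "z \<in> g ` C"
        using g(2)[of z] that(2) by (intro image_eqI[of _ _ "F z"]) auto
      then show False
        using r(2) that(1) by fastforce
    qed
    with r(1) show ?thesis
      by blast
  qed
  have le: "cmod (k z) \<le> 1" if z: "cmod z < 1" for z
  proof (rule norm_le_1_if_boundary_norm_le_1[OF k(1) _ z])
    fix \<epsilon> :: real assume "\<epsilon> > 0"
    then obtain r where "r < 1" and r: "\<And>z. r < cmod z \<Longrightarrow> cmod z < 1 \<Longrightarrow> \<bar>cmod (P (F z)) - 1\<bar> < \<epsilon>"
      using lim by blast
    have "cmod z * cmod (k z) \<le> 1 + \<epsilon>" if "r < cmod z" "cmod z < 1" for z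
    proof -
      have "cmod z * cmod (k z) = cmod (P (F z))"
        using k(2)[OF that(2)] by (simp flip: norm_mult)
      then show ?thesis
        using r[OF that] by linarith
    qed
    with \<open>r < 1\<close> show "\<exists>r<1. \<forall>z. r < cmod z \<and> cmod z < 1 \<longrightarrow> cmod z * cmod (k z) \<le> 1 + \<epsilon>"
      by blast
  qed
  have ge: "cmod (inverse (k z)) \<le> 1" if z: "cmod z < 1" for z
  proof (rule norm_le_1_if_boundary_norm_le_1[OF _ _ z])
    show "(\<lambda>z. inverse (k z)) holomorphic_on ball 0 1"
      using knz by (intro holomorphic_intros k(1)) auto
    fix \<epsilon> :: real assume \<epsilon>: "\<epsilon> > 0"
    \<comment> \<open>This tolerance turns the lower bound into \<open>1 / (1 + \<epsilon>)\<close>,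
      which inverts to \<open>1 + \<epsilon>\<close>.\<close>
    then have "\<epsilon> / (1 + \<epsilon>) > 0"
      by simp
    then obtain r where "r < 1" and r: "\<And>z. r < cmod z \<Longrightarrow> cmod z < 1 \<Longrightarrow> \<bar>cmod (P (F z)) - 1\<bar> < \<epsilon> / (1 + \<epsilon>)"
      using lim by blast
    have "cmod z * cmod (inverse (k z)) \<le> 1 + \<epsilon>" if "r < cmod z" "cmod z < 1" for z
    proof -
      have "1 - \<epsilon> / (1 + \<epsilon>) < cmod (P (F z))"
        using r[OF that] by linarith
      also have "\<dots> = cmod z * cmod (k z)"
        using k(2)[OF that(2)] by (simp flip: norm_mult)
      also have "\<dots> \<le> cmod (k z)"
        using that(2) by (simp add: mult_left_le_one_le)
      also have "1 - \<epsilon> / (1 + \<epsilon>) = 1 / (1 + \<epsilon>)"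
        using \<epsilon> by (simp add: field_simps)
      finally have "inverse (cmod (k z)) < 1 + \<epsilon>"
        using \<epsilon> knz[OF that(2)] by (simp add: field_simps)
      then have "cmod (inverse (k z)) < 1 + \<epsilon>"
        by (simp add: norm_inverse)
      moreover have "cmod z * cmod (inverse (k z)) \<le> cmod (inverse (k z))"
        using that(2) by (intro mult_left_le_one_le) auto
      ultimately show ?thesis
        by linarith
    qed
    with \<open>r < 1\<close> show "\<exists>r<1. \<forall>z. r < cmod z \<and> cmod z < 1 \<longrightarrow> cmod z * cmod (inverse (k z)) \<le> 1 + \<epsilon>"
      by blast
  qed
  have k1: "cmod (k z) = 1" if "cmod z < 1" for z
    using le[OF that] ge[OF that] knz[OF that] by (simp add: norm_inverse inverse_le_1_iff)
  have "k constant_on ball 0 1"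
    by (rule maximum_modulus_principle[OF k(1), of "ball 0 1" 0]) (use k1 in auto)
  then obtain c where c: "\<And>z. cmod z < 1 \<Longrightarrow> k z = c"
    by (auto simp: constant_on_def)
  show thesis
    using that[of c] k1[of 0] k(2) c by simp
qed

text \<open>Three differentiations of \<open>P (F z) = c * z\<close>. As P''(0) = 0, what remains at
  0 is F''' P' + P''' F'^3 = 0, while the first derivative gives |P'| |F'| = 1.\<close>

lemma third_deriv_inverse_conformal:
  assumes F: "F holomorphic_on ball 0 1" "F 0 = 0" "\<And>z. cmod z < 1 \<Longrightarrow> F z \<in> E"
    and P: "P holomorphic_on E" "open E" "deriv (deriv P) 0 = 0"
    and eq: "\<And>z. cmod z < 1 \<Longrightarrow> P (F z) = c * z" and "cmod c = 1"
  shows "cmod ((deriv ^^ 3) F 0 / deriv F 0) = cmod ((deriv ^^ 3) P 0) / cmod (deriv P 0) ^ 3"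
proof -
  define F1 F2 F3 where "F1 = deriv F" and "F2 = deriv F1" and "F3 = deriv F2"
  define P1 P2 P3 where "P1 = deriv P" and "P2 = deriv P1" and "P3 = deriv P2"
  have dF: "(F has_field_derivative F1 z) (at z)" "(F1 has_field_derivative F2 z) (at z)"
    "(F2 has_field_derivative F3 z) (at z)" if "cmod z < 1" for z
    unfolding F3_def F2_def F1_def
    by (rule holomorphic_derivI[where S = "ball 0 1"]; use that in \<open>auto intro!: holomorphic_intros F(1)\<close>)+
  have dP: "(P has_field_derivative P1 (F z)) (at (F z))" "(P1 has_field_derivative P2 (F z)) (at (F z))"
    "(P2 has_field_derivative P3 (F z)) (at (F z))" if "cmod z < 1" for z
    unfolding P3_def P2_def P1_def
    by (rule holomorphic_derivI[where S = E]; use that in \<open>auto intro!: holomorphic_intros P F(3)\<close>)+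
  have transfer: "a = b" if "(f has_field_derivative a) (at z)" "(g has_field_derivative b) (at z)"
    "cmod z < 1" "\<And>w. cmod w < 1 \<Longrightarrow> f w = g w" for f g :: "complex \<Rightarrow> complex" and a b z
  proof -
    have "(g has_field_derivative a) (at z)"
      using has_field_derivative_transform_within_open[OF that(1), of "ball 0 1" g] that by auto
    then show ?thesis
      using that(2) DERIV_unique by blast
  qed
  note PF = DERIV_chain2[OF dP(1) dF(1)] DERIV_chain2[OF dP(2) dF(1)] DERIV_chain2[OF dP(3) dF(1)]
  have e1: "P1 (F z) * F1 z = c" if "cmod z < 1" for z
    by (rule transfer[OF PF(1) DERIV_cmult_Id]) (use that eq in auto)
  have e2: "P2 (F z) * F1 z * F1 z + F2 z * P1 (F z) = 0" if "cmod z < 1" for z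
    by (rule transfer[OF DERIV_mult[OF PF(2) dF(2)] DERIV_const]) (use that e1 in auto)
  have "(P3 (F 0) * F1 0 * (F1 0 * F1 0) + (F2 0 * F1 0 + F2 0 * F1 0) * P2 (F 0))
      + (F3 0 * P1 (F 0) + P2 (F 0) * F1 0 * F2 0) = 0"
    by (rule transfer[OF DERIV_add[OF DERIV_mult[OF PF(3) DERIV_mult[OF dF(2) dF(2)]]
        DERIV_mult[OF dF(3) PF(2)]] DERIV_const]) (use e2 in \<open>auto simp: mult.assoc\<close>)
  moreover have "P2 0 = 0"
    using P(3) by (simp add: P2_def P1_def)
  ultimately have "F3 0 * P1 0 = - (P3 0 * F1 0 ^ 3)"
    by (simp add: F(2) power3_eq_cube mult.assoc) (simp add: add_eq_0_iff)
  then have "cmod (F3 0) * cmod (P1 0) = cmod (P3 0) * cmod (F1 0) ^ 3"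
    by (simp flip: norm_mult norm_power)
  moreover have n1: "cmod (P1 0) * cmod (F1 0) = 1"
    using e1[of 0] \<open>cmod c = 1\<close> F(2) by (simp flip: norm_mult)
  ultimately have "cmod (F3 0) / cmod (F1 0) = cmod (P3 0) / cmod (P1 0) ^ 3"
  proof -
    assume a: "cmod (F3 0) * cmod (P1 0) = cmod (P3 0) * cmod (F1 0) ^ 3"
    have nz: "cmod (P1 0) \<noteq> 0" "cmod (F1 0) \<noteq> 0"
      using n1 by auto
    have F1: "cmod (F1 0) = 1 / cmod (P1 0)"
      using n1 nz by (simp add: field_simps)
    show ?thesis
      using a nz(1) unfolding F1 by (simp add: field_simps power3_eq_cube)
  qed
  then show ?thesis
    by (simp add: norm_divide F3_def F2_def F1_def P3_def P2_def P1_def numeral_3_eq_3)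
qed

lemma derivs_mult_exp:
  assumes s: "s holomorphic_on E" and h: "h holomorphic_on E" and E: "open E" "0 \<in> E"
    and "s 0 = 0" "deriv (deriv s) 0 = 0" "deriv h 0 = 0"
  shows "deriv (\<lambda>z. s z * exp (h z)) 0 = deriv s 0 * exp (h 0)"
    and "deriv (deriv (\<lambda>z. s z * exp (h z))) 0 = 0"
    and "(deriv ^^ 3) (\<lambda>z. s z * exp (h z)) 0
      = ((deriv ^^ 3) s 0 + 3 * deriv s 0 * deriv (deriv h) 0) * exp (h 0)"
proof -
  define e where "e = (\<lambda>z. exp (h z))"
  have eh: "e holomorphic_on E"
    unfolding e_def by (intro holomorphic_intros h)
  have h': "(h has_field_derivative deriv h z) (at z)"
    "(deriv h has_field_derivative deriv (deriv h) z) (at z)" if "z \<in> E" for z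
    by (rule holomorphic_derivI[where S = E]; use that in \<open>auto intro!: holomorphic_intros h E\<close>)+
  have e1: "deriv e z = e z * deriv h z" if "z \<in> E" for z
    unfolding e_def by (rule DERIV_imp_deriv) (auto intro!: derivative_eq_intros h' that)
  have e': "(e has_field_derivative e z * deriv h z) (at z)" if "z \<in> E" for z
    unfolding e_def by (auto intro!: derivative_eq_intros h' that)
  have "(deriv e has_field_derivative e 0 * deriv (deriv h) 0) (at 0)"
  proof (rule has_field_derivative_transform_within_open[where S = E])
    show "((\<lambda>z. e z * deriv h z) has_field_derivative e 0 * deriv (deriv h) 0) (at 0)"
      using assms(7) by (auto intro!: derivative_eq_intros e' h' E)
  qed (use E e1 in auto)
  then have e2: "deriv (deriv e) 0 = e 0 * deriv (deriv h) 0"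
    by (rule DERIV_imp_deriv)
  have m: "(deriv ^^ n) (\<lambda>z. s z * e z) 0
      = (\<Sum>i = 0..n. of_nat (n choose i) * (deriv ^^ i) s 0 * (deriv ^^ (n - i)) e 0)" for n
    by (rule higher_deriv_mult[OF s eh E])
  show "deriv (\<lambda>z. s z * exp (h z)) 0 = deriv s 0 * exp (h 0)"
    using m[of 1] assms(5) by (simp add: e_def)
  show "deriv (deriv (\<lambda>z. s z * exp (h z))) 0 = 0"
    using m[of 2] assms(5-7) e1[OF E(2)] by (simp add: numeral_2_eq_2 e_def)
  have "(deriv ^^ 3) (\<lambda>z. s z * e z) 0
      = ((deriv ^^ 3) s 0 + 3 * deriv s 0 * deriv (deriv h) 0) * e 0"
    unfolding m using assms(5-7) e1[OF E(2)] e2 by (simp add: numeral_3_eq_3 algebra_simps)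
  then show "(deriv ^^ 3) (\<lambda>z. s z * exp (h z)) 0
      = ((deriv ^^ 3) s 0 + 3 * deriv s 0 * deriv (deriv h) 0) * exp (h 0)"
    unfolding e_def .
qed

text \<open>\<open>s\<close> carries the simple zero and \<open>h\<close> corrects the modulus on
  the boundary \<open>K - E\<close>. In P'''(0) / P'(0)^3 the factor \<open>exp (h 0)\<close> occurs
  once above and three times below, which leaves \<open>exp (2 * Re (h 0))\<close> in the
  denominator.\<close>

lemma ND_iff_explicit:
  assumes E: "open E" "convex E" "bounded E" "0 \<in> E" and sym: "\<And>z. z \<in> E \<Longrightarrow> - z \<in> E"
    and K: "compact K" "E \<subseteq> K" "continuous_on K s" "continuous_on K h"
    and s: "s holomorphic_on E" "\<And>z. z \<in> E \<Longrightarrow> s z = 0 \<longleftrightarrow> z = 0" "deriv s 0 \<noteq> 0" "deriv (deriv s) 0 = 0"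
    and h: "h holomorphic_on E" "deriv h 0 = 0"
    and boundary: "\<And>z. z \<in> K - E \<Longrightarrow> cmod (s z * exp (h z)) = 1"
    and "v \<noteq> 0" and D: "D = (\<lambda>z. c + v * z) ` E"
  shows "ND D \<longleftrightarrow> cmod ((deriv ^^ 3) s 0 + 3 * deriv s 0 * deriv (deriv h) 0)
    / (cmod (deriv s 0) ^ 3 * exp (2 * Re (h 0))) \<notin> resonant_values"
proof -
  obtain F where F: "conformal_bij F (ball 0 1) E" "F 0 = 0"
    using exists_conformal_bij_disc[OF E] by blast
  define P where "P = (\<lambda>z. s z * exp (h z))"
  have s0: "s 0 = 0"
    using s(2) E(4) by blast
  note d = derivs_mult_exp[OF s(1) h(1) E(1,4) s0 s(4) h(2), folded P_def]
  have Ph: "P holomorphic_on E"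
    unfolding P_def by (intro holomorphic_intros s h)
  have "continuous_on K P"
    unfolding P_def by (intro continuous_intros K)
  then obtain u where u: "cmod u = 1" "\<And>z. cmod z < 1 \<Longrightarrow> P (F z) = u * z"
    using inverse_conformal_from_boundary_modulus[OF F Ph _ _ _ K(1,2)] d(1) s boundary s0
    by (auto simp: P_def)
  have "cmod ((deriv ^^ 3) F 0 / deriv F 0) = cmod ((deriv ^^ 3) P 0) / cmod (deriv P 0) ^ 3"
    using F conformal_bij_memD[OF F(1)] d(2) u
    by (intro third_deriv_inverse_conformal[where E = E and c = u] Ph E) (auto simp: conformal_bij_def)
  also have "\<dots> = cmod ((deriv ^^ 3) s 0 + 3 * deriv s 0 * deriv (deriv h) 0)
    / (cmod (deriv s 0) ^ 3 * exp (2 * Re (h 0)))"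
    by (simp add: d norm_mult norm_exp power_mult_distrib exp_double power2_eq_square power3_eq_cube)
  finally show ?thesis
    using ND_affine_iff[OF E sym F \<open>v \<noteq> 0\<close> D] by simp
qed

section \<open>Series depending analytically on a nome\<close>

text \<open>The majorant is required on all of \<open>K\<close> and not just on compact parts of
  \<open>E\<close>: uniform convergence up to the boundary makes the sum continuous there, as
  \<open>ND_iff_explicit\<close> demands.\<close>

lemma holomorphic_series:
  fixes b :: "nat \<Rightarrow> complex \<Rightarrow> complex"
  assumes E: "open E" "E \<subseteq> K"
    and b: "\<And>n. b n holomorphic_on E" "\<And>n. continuous_on K (b n)"
    and M: "\<And>n z. z \<in> K \<Longrightarrow> cmod (b n z) \<le> M n" "summable M"
  shows "continuous_on K (\<lambda>z. \<Sum>n. b n z)"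
    and "(\<lambda>z. \<Sum>n. b n z) holomorphic_on E"
    and "z \<in> E \<Longrightarrow> (\<lambda>n. (deriv ^^ m) (b n) z) sums (deriv ^^ m) (\<lambda>z. \<Sum>n. b n z) z"
proof -
  have ul: "uniform_limit K (\<lambda>n z. \<Sum>i<n. b i z) (\<lambda>z. \<Sum>n. b n z) sequentially"
    by (rule Weierstrass_m_test[OF M])
  then show "continuous_on K (\<lambda>z. \<Sum>n. b n z)"
    by (rule uniform_limit_theorem[rotated]) (auto intro!: always_eventually continuous_intros b)
  have ulE: "uniform_limit E (\<lambda>n z. \<Sum>i<n. b i z) (\<lambda>z. \<Sum>n. b n z) sequentially"
    by (rule uniform_limit_on_subset[OF ul E(2)])
  have hol: "(\<lambda>z. \<Sum>i<n. b i z) holomorphic_on E" for n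
    by (intro holomorphic_intros b)
  show "(\<lambda>z. \<Sum>n. b n z) holomorphic_on E"
  proof (rule holomorphic_uniform_sequence[OF E(1)])
    fix x assume "x \<in> E"
    then obtain d where "0 < d" "cball x d \<subseteq> E"
      using E(1) open_contains_cball by blast
    then show "\<exists>d>0. cball x d \<subseteq> E \<and>
        uniform_limit (cball x d) (\<lambda>n z. \<Sum>i<n. b i z) (\<lambda>z. \<Sum>n. b n z) sequentially"
      using uniform_limit_on_subset[OF ulE] by blast
  qed (rule hol)
  show "(\<lambda>n. (deriv ^^ m) (b n) z) sums (deriv ^^ m) (\<lambda>z. \<Sum>n. b n z) z" if z: "z \<in> E"
  proof -
    have "(deriv ^^ m) (\<lambda>z. \<Sum>i<n. b i z) z = (\<Sum>i<n. (deriv ^^ m) (b i) z)" for n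
    proof (induction n)
      case (Suc n)
      then show ?case
        using higher_deriv_add[OF hol b(1) E(1) z] by simp
    qed simp
    moreover have "(\<lambda>n. (deriv ^^ m) (\<lambda>z. \<Sum>i<n. b i z) z) \<longlonglongrightarrow> (deriv ^^ m) (\<lambda>z. \<Sum>n. b n z) z"
      by (rule higher_deriv_complex_uniform_limit[OF ulE _ _ E(1) z]) (auto intro!: always_eventually hol)
    ultimately show ?thesis
      by (simp add: sums_def)
  qed
qed

lemma fsigma_ball: "fsigma (ball (0 :: complex) 1)"
proof -
  have "ball (0 :: complex) 1 = (\<Union>n. cball 0 (1 - 1 / real (Suc n)))"
  proof (intro equalityI subsetI)
    fix z :: complex assume "z \<in> ball 0 1"
    then obtain n where "inverse (real (Suc n)) < 1 - cmod z"
      using reals_Archimedean[of "1 - cmod z"] by auto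
    then show "z \<in> (\<Union>n. cball 0 (1 - 1 / real (Suc n)))"
      by (auto simp: inverse_eq_divide intro!: exI[of _ n])
  next
    fix z :: complex assume "z \<in> (\<Union>n. cball 0 (1 - 1 / real (Suc n)))"
    then obtain n where "cmod z \<le> 1 - 1 / real (Suc n)"
      by auto
    also have "\<dots> < 1"
      by simp
    finally show "z \<in> ball 0 1"
      by simp
  qed
  then show ?thesis
    using fsigma.intros[of "\<lambda>n. cball (0 :: complex) (1 - 1 / real (Suc n))"] by simp
qed

text \<open>The nonzero derivative certifies that \<open>g\<close> is not constant, and a
  nonconstant holomorphic function has only countably many zeros on the disc, an F-sigma
  set.\<close>

lemma countable_real_zeros_disc:
  assumes g: "g holomorphic_on ball 0 1" and "(g has_field_derivative d) (at 0)" "d \<noteq> 0"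
  shows "countable {x :: real. \<bar>x\<bar> < 1 \<and> g (of_real x) = 0}"
proof -
  have "\<not> g constant_on ball 0 1"
  proof
    assume "g constant_on ball 0 1"
    then obtain c where c: "\<And>z. z \<in> ball 0 1 \<Longrightarrow> g z = c"
      by (auto simp: constant_on_def)
    have "(g has_field_derivative 0) (at 0)"
      by (rule has_field_derivative_transform_within_open[where f = "\<lambda>_. c" and S = "ball 0 1"])
        (use c in auto)
    then show False
      using assms(2,3) DERIV_unique by blast
  qed
  then have "countable {z \<in> ball 0 1. g z = 0}"
    by (intro holomorphic_countable_zeros g fsigma_ball) auto
  then have "countable (Re ` {z \<in> ball 0 1. g z = 0})"
    by simp
  then show ?thesis
  proof (rule countable_subset[rotated], intro subsetI)
    fix x assume "x \<in> {x. \<bar>x\<bar> < 1 \<and> g (complex_of_real x) = 0}"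
    then show "x \<in> Re ` {z \<in> ball 0 1. g z = 0}"
      by (intro image_eqI[of _ _ "complex_of_real x"]) auto
  qed
qed

section \<open>Lambert series in the nome and their level sets\<close>

text \<open>With \<open>k = Suc n\<close> and \<open>q = exp (- 4 * t)\<close> the factor is exp (-
  2 k t) / (2 cosh (2 k t)). The type is polymorphic since shapes give real \<open>q\<close>,
  whereas the identity theorem needs complex \<open>q\<close>.\<close>

definition lambert :: "(nat \<Rightarrow> real) \<Rightarrow> 'a::{real_normed_field,banach} \<Rightarrow> 'a" where
  "lambert a q = (\<Sum>n. of_real (a n) * (q ^ Suc n / (1 + q ^ Suc n)))"

text \<open>The denominator has norm at least \<open>1 - r\<close>, so the bound is uniform for
  \<open>norm q \<le> r\<close>. Linear growth of the coefficients covers both weights that occur,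
  \<open>1 / k\<close> in \<open>h 0\<close> and \<open>k\<close> in its second derivative.\<close>

lemma lambert_term_bound:
  fixes q :: "'a::{real_normed_field,banach}"
  assumes "norm q \<le> r" "r < 1" and "\<bar>a n\<bar> \<le> real (Suc n)"
  shows "norm (of_real (a n) * (q ^ Suc n / (1 + q ^ Suc n))) \<le> real (Suc n) * r ^ Suc n / (1 - r)"
proof -
  have r: "0 \<le> r"
    using assms(1) norm_ge_zero order_trans by blast
  have pw: "norm (q ^ Suc n) \<le> r ^ Suc n"
    unfolding norm_power by (rule power_mono[OF assms(1)]) simp
  have "r ^ Suc n \<le> r"
    using r assms(2) by (simp add: mult_left_le power_le_one)
  then have "1 - r \<le> 1 - norm (q ^ Suc n)"
    using pw by linarith
  also have "\<dots> \<le> norm (1 + q ^ Suc n)"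
    using norm_diff_ineq[of 1 "q ^ Suc n"] by simp
  finally have "norm (q ^ Suc n / (1 + q ^ Suc n)) \<le> r ^ Suc n / (1 - r)"
    unfolding norm_divide using pw assms(2) r by (intro frac_le) auto
  then have "\<bar>a n\<bar> * norm (q ^ Suc n / (1 + q ^ Suc n)) \<le> real (Suc n) * (r ^ Suc n / (1 - r))"
    using assms(3) by (intro mult_mono) auto
  also have "real (Suc n) * (r ^ Suc n / (1 - r)) = real (Suc n) * r ^ Suc n / (1 - r)"
    by simp
  also have "\<bar>a n\<bar> * norm (q ^ Suc n / (1 + q ^ Suc n)) = norm (of_real (a n) * (q ^ Suc n / (1 + q ^ Suc n)))"
    by (simp only: norm_mult norm_of_real)
  finally show ?thesis .
qed

lemma summable_lambert_bound:
  assumes "0 \<le> r" "r < (1::real)"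
  shows "summable (\<lambda>n. real (Suc n) * r ^ Suc n / (1 - r))"
proof -
  have "summable (\<lambda>n. of_nat (Suc n) * r ^ n)"
    using geometric_deriv_sums[of r] assms by (auto simp: sums_iff)
  from summable_mult2[OF this, of "r / (1 - r)"] show ?thesis
    by (simp add: mult_ac)
qed

lemma summable_lambert:
  fixes q :: "'a::{real_normed_field,banach}"
  assumes "norm q < 1" and "\<And>n. \<bar>a n\<bar> \<le> real (Suc n)"
  shows "summable (\<lambda>n. of_real (a n) * (q ^ Suc n / (1 + q ^ Suc n)))"
  by (rule summable_comparison_test'[OF summable_lambert_bound[of "norm q"], of 0])
    (use assms lambert_term_bound[of q "norm q" a] in auto)

lemma lambert_of_real:
  fixes q :: real
  assumes "\<bar>q\<bar> < 1" and "\<And>n. \<bar>a n\<bar> \<le> real (Suc n)"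
  shows "lambert a (complex_of_real q) = of_real (lambert a q)"
  unfolding lambert_def
  using sums_of_real[OF summable_sums[OF summable_lambert[of q a]], where 'a = complex] assms
  by (simp add: sums_iff)

lemma lambert_0 [simp]: "lambert a 0 = 0"
  by (simp add: lambert_def)

text \<open>The majorant depends on \<open>r\<close> and degenerates as \<open>r\<close> tends to 1,
  so holomorphy is proved on each smaller disc. At 0 every term with \<open>n > 0\<close> vanishes
  to order at least 2, which leaves \<open>a 0\<close> as the derivative.\<close>

lemma lambert_holomorphic:
  assumes a: "\<And>n. \<bar>a n\<bar> \<le> real (Suc n)"
  shows "lambert a holomorphic_on ball 0 1"
    and "(lambert a has_field_derivative complex_of_real (a 0)) (at 0)"
proof -
  define b where "b = (\<lambda>n (q::complex). of_real (a n) * (q ^ Suc n / (1 + q ^ Suc n)))"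
  have lam: "lambert a = (\<lambda>q. \<Sum>n. b n q)"
    by (auto simp: lambert_def b_def)
  have nz: "1 + q ^ Suc n \<noteq> 0" if "cmod q < 1" for q n
  proof
    assume "1 + q ^ Suc n = 0"
    then have "cmod (q ^ Suc n) = 1"
      by (metis add_eq_0_iff norm_minus_cancel norm_one)
    moreover have "cmod q ^ Suc n < 1"
      using that power_strict_mono[of "cmod q" 1 "Suc n"] by simp
    ultimately show False
      by (simp only: norm_power)
  qed
  have bh: "b n holomorphic_on ball 0 1" for n
    unfolding b_def using nz by (intro holomorphic_intros) auto
  have ser: "lambert a holomorphic_on ball 0 r"
    "(\<lambda>n. (deriv ^^ 1) (b n) 0) sums (deriv ^^ 1) (lambert a) 0"
    if r: "0 < r" "r < 1" for r
  proof -
    have 1: "b n holomorphic_on ball 0 r" for n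
      using r by (intro holomorphic_on_subset[OF bh]) auto
    have 2: "continuous_on (ball 0 r) (b n)" for n
      using 1 by (rule holomorphic_on_imp_continuous_on)
    have 3: "cmod (b n z) \<le> real (Suc n) * r ^ Suc n / (1 - r)" if "z \<in> ball 0 r" for n z
      unfolding b_def using lambert_term_bound[of z r a n] a r that by simp
    have 4: "summable (\<lambda>n. real (Suc n) * r ^ Suc n / (1 - r))"
      using r by (intro summable_lambert_bound) auto
    note series = holomorphic_series[OF open_ball order_refl 1 2 3 4, folded lam]
    show "lambert a holomorphic_on ball 0 r"
      by (rule series(2))
    show "(\<lambda>n. (deriv ^^ 1) (b n) 0) sums (deriv ^^ 1) (lambert a) 0"
      using r by (intro series(3)) auto
  qed
  have "lambert a field_differentiable at z" if "cmod z < 1" for z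
  proof -
    have "z \<in> ball 0 ((1 + cmod z) / 2)"
      using that by simp
    then show ?thesis
      using that by (intro holomorphic_on_imp_differentiable_at[OF ser(1)[of "(1 + cmod z) / 2"]])
        (auto intro: add_pos_nonneg)
  qed
  then show hol: "lambert a holomorphic_on ball 0 1"
    by (auto simp: holomorphic_on_def intro: field_differentiable_at_within)
  have "deriv (b n) 0 = (if n = 0 then of_real (a 0) else 0)" for n
    unfolding b_def by (rule DERIV_imp_deriv) (auto intro!: derivative_eq_intros)
  then have "deriv (lambert a) 0 = complex_of_real (a 0)"
    using ser(2)[of "1/2"] sums_unique2[OF _ sums_single[of 0 "\<lambda>_. complex_of_real (a 0)"]]
    by simp
  then show "(lambert a has_field_derivative complex_of_real (a 0)) (at 0)"
    using holomorphic_derivI[OF hol open_ball, of 0 UNIV] by simp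
qed

lemma lambert_pos:
  fixes q :: real
  assumes "0 < q" "q < 1" and a: "\<And>n. \<bar>a n\<bar> \<le> real (Suc n)" "\<And>n. a n \<ge> 0" "a 0 > 0"
  shows "lambert a q > 0"
  unfolding lambert_def
proof (rule suminf_pos2)
  show "summable (\<lambda>n. of_real (a n) * (q ^ Suc n / (1 + q ^ Suc n)))"
    using assms by (intro summable_lambert) auto
  show "0 < of_real (a 0) * (q ^ Suc 0 / (1 + q ^ Suc 0))"
    using assms by (simp add: zero_less_divide_iff add_pos_pos)
qed (use assms in \<open>auto intro!: mult_nonneg_nonneg divide_nonneg_nonneg add_nonneg_nonneg\<close>)

text \<open>The equation is multiplied by \<open>x\<close>, so that both sides become holomorphic at \<open>0\<close>,
  where the derivative of their difference is \<open>- v\<close>.\<close>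

lemma countable_ellipse_level:
  assumes a: "\<And>n. \<bar>a n\<bar> \<le> real (Suc n)" and b: "\<And>n. \<bar>b n\<bar> \<le> real (Suc n)" and "v \<noteq> 0"
  shows "countable {x :: real. 0 < x \<and> x < 1 \<and> 6 / x * lambert a (x\<^sup>2) * exp (- (4 * lambert b (x\<^sup>2))) = v}"
proof -
  define g :: "complex \<Rightarrow> complex" where
    "g = (\<lambda>z. 6 * lambert a (z\<^sup>2) * exp (- (4 * lambert b (z\<^sup>2))) - of_real v * z)"
  have sq: "(\<lambda>z. z\<^sup>2) ` ball 0 1 \<subseteq> ball (0::complex) 1"
    by (auto simp: norm_power power_less_one_iff abs_square_less_1)
  have hol: "(\<lambda>z. lambert a (z\<^sup>2)) holomorphic_on ball 0 1" if "\<And>n. \<bar>a n\<bar> \<le> real (Suc n)" for a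
    using holomorphic_on_compose_gen[OF _ lambert_holomorphic(1)[OF that] sq]
    by (simp add: o_def holomorphic_intros)
  have d: "((\<lambda>z. lambert a (z\<^sup>2)) has_field_derivative 0) (at (0::complex))"
    if "\<And>n. \<bar>a n\<bar> \<le> real (Suc n)" for a
  proof -
    have "(lambert a has_field_derivative of_real (a 0)) (at ((0::complex)\<^sup>2))"
      using lambert_holomorphic(2)[OF that] by simp
    moreover have "((\<lambda>z. z\<^sup>2) has_field_derivative 0) (at (0::complex))"
      by (auto intro!: derivative_eq_intros)
    ultimately show ?thesis
      using DERIV_chain2[of "lambert a" "of_real (a 0)" "\<lambda>z. z\<^sup>2" 0 0 UNIV] by simp
  qed
  have "g holomorphic_on ball 0 1"
    unfolding g_def by (intro holomorphic_intros hol a b)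
  moreover have "(g has_field_derivative - of_real v) (at 0)"
    unfolding g_def by (auto intro!: derivative_eq_intros d a b)
  ultimately have "countable {x :: real. \<bar>x\<bar> < 1 \<and> g (of_real x) = 0}"
    using countable_real_zeros_disc[of g "- of_real v"] \<open>v \<noteq> 0\<close> by simp
  then show ?thesis
  proof (rule countable_subset[rotated], intro subsetI)
    fix x :: real
    assume "x \<in> {x. 0 < x \<and> x < 1 \<and> 6 / x * lambert a (x\<^sup>2) * exp (- (4 * lambert b (x\<^sup>2))) = v}"
    then have x: "0 < x" "x < 1" and eq: "6 / x * lambert a (x\<^sup>2) * exp (- (4 * lambert b (x\<^sup>2))) = v"
      by auto
    have x2: "\<bar>x\<^sup>2\<bar> < 1"
      using x by (simp add: abs_square_less_1)
    have "6 * lambert a (x\<^sup>2) * exp (- (4 * lambert b (x\<^sup>2))) - v * x = 0"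
      using eq x by (simp add: field_simps)
    then have "complex_of_real (6 * lambert a (x\<^sup>2) * exp (- (4 * lambert b (x\<^sup>2))) - v * x) = 0"
      by simp
    then have "g (of_real x) = 0"
      using lambert_of_real[OF x2 a] lambert_of_real[OF x2 b] by (simp add: g_def flip: exp_of_real)
    then show "x \<in> {x. \<bar>x\<bar> < 1 \<and> g (of_real x) = 0}"
      using x by simp
  qed
qed

text \<open>The derivative at 0 is 48 + (-2) (-8) = 64, nonzero for every level \<open>v\<close>,
  including -2, the value taken at 0 itself.\<close>

lemma countable_rectangle_level:
  assumes a: "\<And>n. \<bar>a n\<bar> \<le> real (Suc n)" "a 0 = 1" and b: "\<And>n. \<bar>b n\<bar> \<le> real (Suc n)" "b 0 = 1"
  shows "countable {x :: real. 0 < x \<and> x < 1 \<and> (48 * lambert a x - 2) * exp (- (8 * lambert b x)) = v}"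
proof -
  define g :: "complex \<Rightarrow> complex" where
    "g = (\<lambda>z. (48 * lambert a z - 2) * exp (- (8 * lambert b z)) - of_real v)"
  have "g holomorphic_on ball 0 1"
    unfolding g_def by (intro holomorphic_intros lambert_holomorphic a b)
  moreover have "(g has_field_derivative 64) (at 0)"
    unfolding g_def
    by (auto intro!: derivative_eq_intros lambert_holomorphic(2)[OF a(1)] lambert_holomorphic(2)[OF b(1)] simp: a b)
  ultimately have "countable {x :: real. \<bar>x\<bar> < 1 \<and> g (of_real x) = 0}"
    using countable_real_zeros_disc[of g 64] by simp
  then show ?thesis
  proof (rule countable_subset[rotated], intro subsetI)
    fix x :: real
    assume "x \<in> {x. 0 < x \<and> x < 1 \<and> (48 * lambert a x - 2) * exp (- (8 * lambert b x)) = v}"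
    then have x: "0 < x" "x < 1" and eq: "(48 * lambert a x - 2) * exp (- (8 * lambert b x)) - v = 0"
      by auto
    then have x1: "\<bar>x\<bar> < 1"
      by simp
    from eq have "complex_of_real ((48 * lambert a x - 2) * exp (- (8 * lambert b x)) - v) = 0"
      by simp
    then have "g (of_real x) = 0"
      using lambert_of_real[OF x1 a(1)] lambert_of_real[OF x1 b(1)] by (simp add: g_def flip: exp_of_real)
    then show "x \<in> {x. \<bar>x\<bar> < 1 \<and> g (of_real x) = 0}"
      using x by simp
  qed
qed

lemma countable_resonant_values: "countable resonant_values"
proof -
  have "{2 * sqrt (1 - 1 / (real n)\<^sup>2) |n::nat. n \<ge> 1} \<subseteq> range (\<lambda>n::nat. 2 * sqrt (1 - 1 / (real n)\<^sup>2))"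
    by auto
  then show ?thesis
    unfolding resonant_values_def by (auto intro: countable_subset)
qed

text \<open>The artanh series; \<open>even n\<close> selects the odd exponents
  \<open>Suc n\<close>.\<close>

lemma sums_odd_terms_Ln:
  assumes "cmod w < 1"
  shows "(\<lambda>n. of_bool (even n) * w ^ Suc n / of_nat (Suc n)) sums ((Ln (1 + w) - Ln (1 - w)) / 2)"
proof -
  have 1: "(\<lambda>n. - ((- w) ^ n) / of_nat n) sums Ln (1 + w)"
    using Ln_series'[OF assms] .
  have 2: "(\<lambda>n. - (w ^ n) / of_nat n) sums Ln (1 - w)"
    using Ln_series'[of "- w"] assms by simp
  have "(\<lambda>n. (- ((- w) ^ n) / of_nat n - - (w ^ n) / of_nat n) / 2) sums ((Ln (1 + w) - Ln (1 - w)) / 2)"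
    by (intro sums_divide sums_diff 1 2)
  then have "(\<lambda>n. (- ((- w) ^ Suc n) / of_nat (Suc n) - - (w ^ Suc n) / of_nat (Suc n)) / 2)
      sums ((Ln (1 + w) - Ln (1 - w)) / 2)"
    by (subst sums_Suc_iff) simp
  moreover have "(- ((- w) ^ Suc n) / of_nat (Suc n) - - (w ^ Suc n) / of_nat (Suc n)) / 2
      = of_bool (even n) * w ^ Suc n / of_nat (Suc n)" for n
    by (simp add: power_minus' del: of_nat_Suc power_Suc)
  ultimately show ?thesis
    by (simp only:)
qed

lemma sums_Ln_one_minus:
  assumes "cmod w < 1"
  shows "(\<lambda>n. w ^ Suc n / of_nat (Suc n)) sums (- Ln (1 - w))"
proof -
  have "(\<lambda>n. - (w ^ n) / of_nat n) sums Ln (1 - w)"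
    using Ln_series'[of "- w"] assms by simp
  from sums_minus[OF this] have "(\<lambda>n. w ^ n / of_nat n) sums (- Ln (1 - w))"
    by simp
  then show ?thesis
    by (subst sums_Suc_iff) simp
qed

section \<open>Ellipses\<close>

text \<open>\<open>cheb n\<close> is \<open>(-1)^n T\<close> for the Chebyshev polynomial \<open>T\<close> of degree \<open>2 n\<close>.\<close>

fun cheb :: "nat \<Rightarrow> complex poly" where
  "cheb 0 = 1"
| "cheb (Suc 0) = [:1, 0, -2:]"
| "cheb (Suc (Suc n)) = [:2, 0, -4:] * cheb (Suc n) - cheb n"

text \<open>The Chebyshev polynomial of degree 2 n takes the value (-1)^n cos (2 n u) at sin u,
  whence the sign in \<open>cheb\<close>; using \<open>sin\<close> puts the centre 0 at
  \<open>u = 0\<close>. The recursion is the sum formula for cosines with step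
  \<open>2 * u\<close>.\<close>

lemma cheb_sin: "poly (cheb n) (sin u) = cos (of_nat (2 * n) * u)"
proof (induction n rule: cheb.induct)
  case 2
  show ?case
    using cos_double_sin[of u] by (simp add: power2_eq_square algebra_simps)
next
  case (3 n)
  have "cos (of_nat (2 * Suc (Suc n)) * u) + cos (of_nat (2 * n) * u)
      = 2 * cos (2 * u) * cos (of_nat (2 * Suc n) * u)"
  proof -
    have "of_nat (2 * Suc (Suc n)) * u = of_nat (2 * Suc n) * u + 2 * u"
      "of_nat (2 * n) * u = of_nat (2 * Suc n) * u - 2 * u"
      by (simp_all add: algebra_simps)
    then show ?thesis
      by (simp only: cos_add cos_diff) (simp add: algebra_simps)
  qed
  note sum = this
  have "poly (cheb (Suc (Suc n))) (sin u)
      = 2 * (1 - 2 * (sin u)\<^sup>2) * poly (cheb (Suc n)) (sin u) - poly (cheb n) (sin u)"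
    by (simp add: power2_eq_square algebra_simps)
  also have "\<dots> = 2 * cos (2 * u) * cos (of_nat (2 * Suc n) * u) - cos (of_nat (2 * n) * u)"
    by (simp only: 3 cos_double_sin)
  finally show ?case
    by (simp only: sum[symmetric] add_diff_cancel_right')
qed simp

lemma cheb_coeffs: "coeff (cheb n) 0 = 1 \<and> coeff (cheb n) (Suc 0) = 0 \<and> coeff (cheb n) (Suc (Suc 0)) = - 2 * (of_nat n)\<^sup>2"
proof (induction n rule: cheb.induct)
  case (3 n)
  then show ?case
    by simp (simp add: power2_eq_square algebra_simps)
qed simp_all

lemma cheb_derivs:
  "poly (cheb n) 0 = 1" "deriv (poly (cheb n)) 0 = 0"
  "deriv (deriv (poly (cheb n))) 0 = - 4 * (of_nat n)\<^sup>2"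
proof -
  have d: "deriv (poly p) = poly (pderiv p)" for p :: "complex poly"
    by (intro ext DERIV_imp_deriv poly_DERIV)
  show "poly (cheb n) 0 = 1" "deriv (poly (cheb n)) 0 = 0"
    "deriv (deriv (poly (cheb n))) 0 = - 4 * (of_nat n)\<^sup>2"
    using cheb_coeffs[of n] by (simp_all add: d poly_0_coeff_0 coeff_pderiv numeral_2_eq_2)
qed

lemma norm_cos_le_exp: "cmod (cos z) \<le> exp \<bar>Im z\<bar>"
proof -
  have "cmod (cos z) \<le> (exp (- Im z) + exp (Im z)) / 2"
    unfolding cos_exp_eq using norm_triangle_ineq[of "exp (\<i> * z)" "exp (- (\<i> * z))"]
    by (simp add: norm_exp norm_divide)
  also have "\<dots> \<le> exp \<bar>Im z\<bar>"
    by (cases "Im z \<ge> 0") auto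
  finally show ?thesis .
qed

definition std_ellipse :: "real \<Rightarrow> real \<Rightarrow> complex set" where
  "std_ellipse a b = {z. (Re z / a)\<^sup>2 + (Im z / b)\<^sup>2 < 1}"

definition std_ellipse_closed :: "real \<Rightarrow> real \<Rightarrow> complex set" where
  "std_ellipse_closed a b = {z. (Re z / a)\<^sup>2 + (Im z / b)\<^sup>2 \<le> 1}"

lemma std_ellipse_closed_compact:
  assumes "a > 0" "b > 0"
  shows "compact (std_ellipse_closed a b)"
proof -
  have "closed (std_ellipse_closed a b)"
    unfolding std_ellipse_closed_def by (intro closed_Collect_le continuous_intros) (use assms in auto)
  moreover have "cmod z \<le> a + b" if "z \<in> std_ellipse_closed a b" for z
  proof -
    have "(Re z / a)\<^sup>2 + (Im z / b)\<^sup>2 \<le> 1"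
      using that by (simp add: std_ellipse_closed_def)
    then have "(Re z / a)\<^sup>2 \<le> 1" "(Im z / b)\<^sup>2 \<le> 1"
      using zero_le_power2[of "Re z / a"] zero_le_power2[of "Im z / b"] by linarith+
    then have "\<bar>Re z\<bar> \<le> a" "\<bar>Im z\<bar> \<le> b"
      using assms by (auto simp: abs_square_le_1)
    then show ?thesis
      using cmod_le[of z] by linarith
  qed
  ultimately show ?thesis
    by (auto simp: compact_eq_bounded_closed bounded_iff)
qed

lemma std_ellipse_props:
  assumes "a > 0" "b > 0"
  shows "open (std_ellipse a b)" "convex (std_ellipse a b)" "bounded (std_ellipse a b)"
    "0 \<in> std_ellipse a b" "z \<in> std_ellipse a b \<Longrightarrow> - z \<in> std_ellipse a b"
    "std_ellipse a b \<subseteq> std_ellipse_closed a b"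
proof -
  show "open (std_ellipse a b)"
    unfolding std_ellipse_def by (intro open_Collect_less continuous_intros) (use assms in auto)
  have eq: "std_ellipse a b = (\<lambda>z. Complex (Re z / a) (Im z / b)) -` ball 0 1"
    by (auto simp: std_ellipse_def cmod_def real_sqrt_lt_1_iff)
  have "linear (\<lambda>z. Complex (Re z / a) (Im z / b))"
    by (intro linearI) (auto simp: complex_eq_iff add_divide_distrib)
  then show "convex (std_ellipse a b)"
    unfolding eq by (intro convex_linear_vimage) auto
  show sub: "std_ellipse a b \<subseteq> std_ellipse_closed a b"
    by (auto simp: std_ellipse_def std_ellipse_closed_def)
  then show "bounded (std_ellipse a b)"
    using std_ellipse_closed_compact[OF assms] bounded_subset compact_imp_bounded by blast
qed (auto simp: std_ellipse_def)

text \<open>The line Im u = t goes to the ellipse with semi-axes cosh t and sinh t. \<open>Q\<close>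
  is a mean, with weights \<open>(sin x)^2\<close> and \<open>(cos x)^2\<close>, of the squares of
  cosh y / cosh \<tau> and sinh y / sinh \<tau>, which lie on the same side of 1.\<close>

lemma ellipse_sin_level:
  fixes u :: complex
  assumes "\<tau> > 0"
  defines "Q \<equiv> (Re (sin u) / cosh \<tau>)\<^sup>2 + (Im (sin u) / sinh \<tau>)\<^sup>2"
  shows "\<bar>Im u\<bar> > \<tau> \<Longrightarrow> Q > 1" and "\<bar>Im u\<bar> < \<tau> \<Longrightarrow> Q < 1"
proof -
  define x y where "x = Re u" and "y = \<bar>Im u\<bar>"
  have pos: "cosh \<tau> > 0" "sinh \<tau> > 0" "y \<ge> 0"
    using assms(1) by (auto simp: y_def)
  have Q: "Q = (sin x)\<^sup>2 * ((cosh y)\<^sup>2 / (cosh \<tau>)\<^sup>2) + (cos x)\<^sup>2 * ((sinh y)\<^sup>2 / (sinh \<tau>)\<^sup>2)"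
  proof -
    have "Re (sin u) = sin x * cosh (Im u)" "Im (sin u) = cos x * sinh (Im u)"
      by (simp_all add: Re_sin Im_sin x_def cosh_field_def sinh_field_def)
    moreover have "cosh y = cosh (Im u)" "(sinh y)\<^sup>2 = (sinh (Im u))\<^sup>2"
      by (auto simp: y_def abs_if)
    ultimately show ?thesis
      by (simp add: Q_def power_divide power_mult_distrib)
  qed
  have one: "(sin x)\<^sup>2 + (cos x)\<^sup>2 = 1"
    by simp
  show "Q > 1" if "\<bar>Im u\<bar> > \<tau>"
  proof -
    have "\<tau> < y"
      using that by (simp add: y_def)
    then have "cosh \<tau> < cosh y" "sinh \<tau> < sinh y"
      using assms(1) by (auto simp: cosh_real_nonneg_less_iff)
    then have "(cosh \<tau>)\<^sup>2 < (cosh y)\<^sup>2" "(sinh \<tau>)\<^sup>2 < (sinh y)\<^sup>2"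
      using pos by (auto intro!: power_strict_mono)
    then have "1 < (cosh y)\<^sup>2 / (cosh \<tau>)\<^sup>2" "1 < (sinh y)\<^sup>2 / (sinh \<tau>)\<^sup>2"
      using pos by simp_all
    then have "min ((cosh y)\<^sup>2 / (cosh \<tau>)\<^sup>2) ((sinh y)\<^sup>2 / (sinh \<tau>)\<^sup>2) > 1" (is "?m > 1")
      by simp
    moreover have "(sin x)\<^sup>2 * ?m + (cos x)\<^sup>2 * ?m \<le> Q"
      unfolding Q by (intro add_mono mult_left_mono) auto
    moreover have "(sin x)\<^sup>2 * ?m + (cos x)\<^sup>2 * ?m = ?m"
      by (simp only: distrib_right[symmetric] one mult_1)
    ultimately show ?thesis
      by linarith
  qed
  show "Q < 1" if "\<bar>Im u\<bar> < \<tau>"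
  proof -
    have "y < \<tau>"
      using that by (simp add: y_def)
    then have "cosh y < cosh \<tau>" "sinh y < sinh \<tau>" "sinh y \<ge> 0"
      using assms(1) pos by (auto simp: cosh_real_nonneg_less_iff)
    then have "(cosh y)\<^sup>2 < (cosh \<tau>)\<^sup>2" "(sinh y)\<^sup>2 < (sinh \<tau>)\<^sup>2"
      using pos by (auto intro!: power_strict_mono)
    then have "(cosh y)\<^sup>2 / (cosh \<tau>)\<^sup>2 < 1" "(sinh y)\<^sup>2 / (sinh \<tau>)\<^sup>2 < 1"
      using pos by simp_all
    then have "max ((cosh y)\<^sup>2 / (cosh \<tau>)\<^sup>2) ((sinh y)\<^sup>2 / (sinh \<tau>)\<^sup>2) < 1" (is "?m < 1")
      by simp
    moreover have "Q \<le> (sin x)\<^sup>2 * ?m + (cos x)\<^sup>2 * ?m"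
      unfolding Q by (intro add_mono mult_left_mono) auto
    moreover have "(sin x)\<^sup>2 * ?m + (cos x)\<^sup>2 * ?m = ?m"
      by (simp only: distrib_right[symmetric] one mult_1)
    ultimately show ?thesis
      by linarith
  qed
qed

lemma exp_real_power: "exp x ^ k = exp (real k * x)" for x :: real
  by (rule exp_of_nat_mult[symmetric])

text \<open>This identity determines the coefficients of both series: the mode of frequency
  \<open>2 * k\<close> has amplitude \<open>cosh (2 * k * \<tau>)\<close> on the boundary, and the
  factor in the nome converts it into the decaying exponential of a logarithmic series.\<close>

lemma cosh_mult_lambert_factor:
  fixes \<tau> :: real
  shows "cosh (2 * real k * \<tau>) * (exp (- 4 * \<tau>) ^ k / (1 + exp (- 4 * \<tau>) ^ k)) = exp (- 2 * real k * \<tau>) / 2"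
proof -
  define E where "E = exp (2 * real k * \<tau>)"
  have E: "E > 0"
    by (simp add: E_def)
  have "real k * (- 4 * \<tau>) = - (2 * real k * \<tau>) + - (2 * real k * \<tau>)"
    by simp
  then have 1: "exp (- 4 * \<tau>) ^ k = inverse E * inverse E"
    unfolding E_def exp_real_power exp_minus[symmetric] exp_add[symmetric] by (rule arg_cong)
  have 2: "cosh (2 * real k * \<tau>) = (E + inverse E) / 2" "exp (- 2 * real k * \<tau>) = inverse E"
    by (simp_all add: E_def cosh_field_def flip: exp_minus)
  have "E\<^sup>2 + 1 \<noteq> 0"
    using E by (simp add: add_nonneg_eq_0_iff)
  then show ?thesis
    unfolding 1 2 using E by (simp add: field_simps power2_eq_square)
qed

text \<open>A mode grows at most like \<open>exp (2 * k * \<tau>)\<close> up to the boundary, while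
  the factor is at most \<open>exp (- 4 * k * \<tau>)\<close>; the surplus gives uniform convergence
  on the closed domain.\<close>

lemma norm_lambert_factor:
  fixes \<tau> :: real
  assumes "\<tau> > 0" "cmod c \<le> exp (2 * real k * \<tau>)"
  shows "cmod (c * of_real (exp (- 4 * \<tau>) ^ k / (1 + exp (- 4 * \<tau>) ^ k))) \<le> exp (- 2 * real k * \<tau>)"
proof -
  have "x / (1 + x) \<le> x" if "x > 0" for x :: real
    using that by (simp add: divide_le_eq algebra_simps)
  then have "exp (- 4 * \<tau>) ^ k / (1 + exp (- 4 * \<tau>) ^ k) \<le> exp (- 4 * \<tau>) ^ k"
    by simp
  also have "\<dots> = exp (- 4 * real k * \<tau>)"
    unfolding exp_real_power by (rule arg_cong) simp
  finally have "cmod c * (exp (- 4 * \<tau>) ^ k / (1 + exp (- 4 * \<tau>) ^ k)) \<le> exp (2 * real k * \<tau>) * exp (- 4 * real k * \<tau>)"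
    using assms by (intro mult_mono) auto
  also have "\<dots> = exp (- 2 * real k * \<tau>)"
    unfolding exp_add[symmetric] by (rule arg_cong) simp
  also have "cmod c * (exp (- 4 * \<tau>) ^ k / (1 + exp (- 4 * \<tau>) ^ k))
      = cmod (c * of_real (exp (- 4 * \<tau>) ^ k / (1 + exp (- 4 * \<tau>) ^ k)))"
    unfolding norm_mult norm_of_real by (subst abs_of_nonneg) auto
  finally show ?thesis .
qed

lemma summable_exp_Suc:
  assumes "\<tau> > (0::real)"
  shows "summable (\<lambda>n. C * exp (- 2 * real (Suc n) * \<tau>))"
proof -
  have "summable (\<lambda>n. exp (- 2 * \<tau>) ^ n)"
    using assms by (intro summable_geometric) simp
  from summable_mult[OF this, of "C * exp (- 2 * \<tau>)"]
  have "summable (\<lambda>n. C * (exp (- 2 * \<tau>) * exp (- 2 * \<tau>) ^ n))"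
    by (simp only: mult.assoc)
  moreover have "exp (- 2 * \<tau>) * exp (- 2 * \<tau>) ^ n = exp (- 2 * real (Suc n) * \<tau>)" for n
    unfolding exp_real_power exp_add[symmetric] by (rule arg_cong) (simp add: algebra_simps)
  ultimately show ?thesis
    by (simp only:)
qed

lemma cis_exp_power: "exp (2 * \<i> * u) ^ k = exp (\<i> * (of_nat (2 * k) * u))" for u :: complex
proof -
  have "of_nat k * (2 * \<i> * u) = \<i> * (of_nat (2 * k) * u)"
    by simp
  then show ?thesis
    unfolding exp_of_nat_mult[symmetric] by (rule arg_cong)
qed

lemma Re_cos_cosh: "Re (cos z) = cos (Re z) * cosh (Im z)"
  by (simp add: Re_cos cosh_field_def)

lemma Re_cosh_cos: "Re (cosh z) = cosh (Re z) * cos (Im z)"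
  by (simp add: cosh_conv_cos Re_cos_cosh)

text \<open>The foci are \<open>\<plusminus> 1\<close> and the boundary is the image under \<open>sin\<close> of the line \<open>Im u = \<tau>\<close>. There
  \<open>2 \<bar>sin u\<bar> = exp \<tau> \<bar>1 - w\<bar>\<close> with \<open>w = exp (2 \<i> u)\<close>, and the coefficients of \<open>h\<close> are chosen such
  that \<open>Re h = - ln \<bar>1 - w\<bar>\<close>.\<close>

lemma ND_ellipse_iff:
  assumes "\<tau> > 0" "v \<noteq> 0" and D: "D = (\<lambda>z. c + v * z) ` std_ellipse (cosh \<tau>) (sinh \<tau>)"
  defines "x \<equiv> exp (- 2 * \<tau>)"
  shows "ND D \<longleftrightarrow> 6 / x * lambert (\<lambda>n. real (Suc n)) (x\<^sup>2)
    * exp (- (4 * lambert (\<lambda>n. 1 / real (Suc n)) (x\<^sup>2))) \<notin> resonant_values"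
proof -
  have ab: "cosh \<tau> > 0" "sinh \<tau> > 0"
    using assms(1) by auto
  define E where "E = std_ellipse (cosh \<tau>) (sinh \<tau>)"
  define K where "K = std_ellipse_closed (cosh \<tau>) (sinh \<tau>)"
  note E = std_ellipse_props[OF ab, folded E_def K_def]
  have x2: "x\<^sup>2 = exp (- 4 * \<tau>)"
    by (simp add: x_def flip: exp_double)
  have x21: "0 < x\<^sup>2" "x\<^sup>2 < 1"
    using assms(1) by (simp_all add: x2)
  define L where "L = (\<lambda>k. (x\<^sup>2) ^ k / (1 + (x\<^sup>2) ^ k))"
  \<comment> \<open>As \<open>cosh (2 * k * \<tau>) * L k = exp (- 2 * k * \<tau>) / 2\<close>, the
    weight \<open>2 / k\<close> yields on the boundary the terms \<open>Re (w ^ k) / k\<close> of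
    the series for \<open>Re (- Ln (1 - w))\<close>.\<close>
  define b where "b = (\<lambda>n z. complex_of_real (2 / real (Suc n)) * (poly (cheb (Suc n)) z * of_real (L (Suc n))))"
  define h where "h = (\<lambda>z. \<Sum>n. b n z)"
  define s where "s = (\<lambda>z. complex_of_real (2 * exp (- \<tau>)) * z)"
  have bh: "b n holomorphic_on S" for n S
    unfolding b_def by (intro holomorphic_intros)
  have bc: "continuous_on S (b n)" for n S
    by (rule holomorphic_on_imp_continuous_on[OF bh])
  have Im_le: "\<bar>Im u\<bar> \<le> \<tau>" if "sin u \<in> K" for u
    using ellipse_sin_level(1)[OF assms(1), of u] that by (force simp: K_def std_ellipse_closed_def)
  have bound: "cmod (b n z) \<le> 2 * exp (- 2 * real (Suc n) * \<tau>)" if z: "z \<in> K" for n z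
  proof -
    define u where "u = Arcsin z"
    have u: "sin u = z"
      by (simp add: u_def)
    define k where "k = Suc n"
    have "k \<ge> 1"
      by (simp add: k_def)
    have "cmod (poly (cheb k) z) \<le> exp \<bar>Im (of_nat (2 * k) * u)\<bar>"
      unfolding u[symmetric] cheb_sin by (rule norm_cos_le_exp)
    also have "\<dots> \<le> exp (2 * real k * \<tau>)"
    proof -
      have "\<bar>Im (of_nat (2 * k) * u)\<bar> = 2 * real k * \<bar>Im u\<bar>"
        by (simp add: abs_mult)
      also have "\<dots> \<le> 2 * real k * \<tau>"
        using Im_le[of u] z u by (intro mult_left_mono) auto
      finally show ?thesis
        by simp
    qed
    finally have "cmod (poly (cheb k) z * of_real (L k)) \<le> exp (- 2 * real k * \<tau>)"
      unfolding L_def x2 using assms(1) by (intro norm_lambert_factor)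
    moreover have "cmod (complex_of_real (2 / real k)) \<le> 2"
      unfolding norm_of_real using \<open>k \<ge> 1\<close> by (simp add: divide_le_eq)
    ultimately have "cmod (complex_of_real (2 / real k)) * cmod (poly (cheb k) z * of_real (L k))
        \<le> 2 * exp (- 2 * real k * \<tau>)"
      by (intro mult_mono) auto
    then show ?thesis
      by (simp only: b_def norm_mult k_def)
  qed
  have series: "continuous_on K h" "h holomorphic_on E"
    "\<And>m z. z \<in> E \<Longrightarrow> (\<lambda>n. (deriv ^^ m) (b n) z) sums (deriv ^^ m) h z"
    unfolding h_def
    by (rule holomorphic_series[OF E(1,6) bh bc bound summable_exp_Suc[OF assms(1)]]; assumption)+
  have lam: "(\<lambda>n. f n * L (Suc n)) sums lambert f (x\<^sup>2)" if "\<And>n. \<bar>f n\<bar> \<le> real (Suc n)" for f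
    using summable_sums[OF summable_lambert[of "x\<^sup>2" f]] x21 that by (simp add: lambert_def L_def)
  have bd: "(deriv ^^ m) (b n) 0 = of_real (2 / real (Suc n) * L (Suc n)) * (deriv ^^ m) (poly (cheb (Suc n))) 0" for m n
  proof -
    define C where "C = complex_of_real (2 / real (Suc n) * L (Suc n))"
    have "b n = (\<lambda>z. C * poly (cheb (Suc n)) z)"
      by (simp add: b_def C_def fun_eq_iff)
    moreover have "poly (cheb (Suc n)) holomorphic_on UNIV"
      by (intro holomorphic_intros)
    ultimately have "(deriv ^^ m) (b n) 0 = C * (deriv ^^ m) (poly (cheb (Suc n))) 0"
      using higher_deriv_cmult[of "poly (cheb (Suc n))" UNIV 0 m] by simp
    then show ?thesis
      by (simp only: C_def)
  qed
  have inv_le: "\<bar>1 / real (Suc n)\<bar> \<le> real (Suc n)" for n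
    by (rule order_trans[of _ 1]) auto
  have h0: "h 0 = of_real (2 * lambert (\<lambda>n. 1 / real (Suc n)) (x\<^sup>2))"
  proof -
    have "(\<lambda>n. 2 * (1 / real (Suc n) * L (Suc n))) sums (2 * lambert (\<lambda>n. 1 / real (Suc n)) (x\<^sup>2))"
      by (intro sums_mult lam inv_le)
    then have "(\<lambda>n. complex_of_real (2 * (1 / real (Suc n) * L (Suc n)))) sums of_real (2 * lambert (\<lambda>n. 1 / real (Suc n)) (x\<^sup>2))"
      by (rule sums_of_real)
    moreover have "complex_of_real (2 * (1 / real (Suc n) * L (Suc n))) = (deriv ^^ 0) (b n) 0" for n
      unfolding bd by (simp add: cheb_derivs)
    ultimately show ?thesis
      using series(3)[OF E(4), of 0] by (simp add: sums_iff)
  qed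
  have h1: "deriv h 0 = 0"
  proof -
    have "(deriv ^^ 1) (b n) 0 = 0" for n
      unfolding bd by (simp add: cheb_derivs)
    then have "(\<lambda>n. 0) sums (deriv ^^ 1) h 0"
      using series(3)[OF E(4), of 1] by (simp only:)
    then show ?thesis
      by (simp add: sums_iff)
  qed
  \<comment> \<open>Termwise, \<open>2 / k\<close> times the second derivative
    \<open>- 4 * k^2\<close> of \<open>cheb k\<close> at 0 gives \<open>- 8 * k\<close>.\<close>
  have h2: "deriv (deriv h) 0 = of_real (- 8 * lambert (\<lambda>n. real (Suc n)) (x\<^sup>2))"
  proof -
    have "(\<lambda>n. - 8 * (real (Suc n) * L (Suc n))) sums (- 8 * lambert (\<lambda>n. real (Suc n)) (x\<^sup>2))"
      by (intro sums_mult lam) auto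
    then have "(\<lambda>n. complex_of_real (- 8 * (real (Suc n) * L (Suc n)))) sums of_real (- 8 * lambert (\<lambda>n. real (Suc n)) (x\<^sup>2))"
      by (rule sums_of_real)
    moreover have "complex_of_real (- 8 * (real (Suc n) * L (Suc n))) = (deriv ^^ 2) (b n) 0" for n
      unfolding bd by (simp add: numeral_2_eq_2 cheb_derivs power2_eq_square del: of_nat_Suc)
    ultimately have "(deriv ^^ 2) h 0 = of_real (- 8 * lambert (\<lambda>n. real (Suc n)) (x\<^sup>2))"
      using series(3)[OF E(4), of 2] by (simp only: sums_iff)
    then show ?thesis
      by (simp add: numeral_2_eq_2)
  qed
  have boundary: "cmod (s z * exp (h z)) = 1" if z: "z \<in> K - E" for z
  proof -
    have "\<exists>u. sin u = z \<and> Im u = \<tau>"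
    proof -
      define u where "u = Arcsin z"
      have u: "sin u = z"
        by (simp add: u_def)
      have "\<not> \<bar>Im u\<bar> < \<tau>" "\<not> \<bar>Im u\<bar> > \<tau>"
        using ellipse_sin_level[OF assms(1), of u] z unfolding u
        by (auto simp: K_def E_def std_ellipse_closed_def std_ellipse_def)
      then consider "Im u = \<tau>" | "Im u = - \<tau>"
        by linarith
      then show ?thesis
      proof cases
        \<comment> \<open>Replacing u by pi - u keeps the sine and reverses the sign of the
          imaginary part.\<close>
        case 2
        then show ?thesis
          using u by (intro exI[of _ "of_real pi - u"]) (auto simp: sin_diff simp flip: sin_of_real cos_of_real)
      qed (use u in blast)
    qed
    then obtain u where u: "sin u = z" "Im u = \<tau>"
      by blast
    define w where "w = exp (2 * \<i> * u)"
    have w: "cmod w < 1"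
      using u(2) assms(1) by (simp add: w_def norm_exp)
    have "Re (b n z) = Re (w ^ Suc n / of_nat (Suc n))" for n
    proof -
      define k where "k = Suc n"
      have "Re (b n z) = 2 / real k * (Re (cos (of_nat (2 * k) * u)) * L k)"
        unfolding b_def u(1)[symmetric] cheb_sin k_def[symmetric]
        by (simp only: Re_complex_of_real Im_complex_of_real times_complex.sel) simp
      also have "Re (cos (of_nat (2 * k) * u)) = cos (2 * real k * Re u) * cosh (2 * real k * \<tau>)"
        unfolding Re_cos_cosh using u(2) by simp
      also have "2 / real k * (cos (2 * real k * Re u) * cosh (2 * real k * \<tau>) * L k)
          = 2 / real k * (cos (2 * real k * Re u) * (cosh (2 * real k * \<tau>) * L k))"
        by (simp only: mult.assoc)
      also have "cosh (2 * real k * \<tau>) * L k = exp (- 2 * real k * \<tau>) / 2"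
        unfolding L_def x2 by (rule cosh_mult_lambert_factor)
      also have "2 / real k * (cos (2 * real k * Re u) * (exp (- 2 * real k * \<tau>) / 2))
          = Re (w ^ k) / real k"
        unfolding w_def cis_exp_power Re_exp using u(2) by (simp add: field_simps)
      also have "\<dots> = Re (w ^ k / of_nat k)"
        by (simp add: Re_divide_of_nat)
      finally show ?thesis
        by (simp add: k_def)
    qed
    moreover have "(\<lambda>n. Re (b n z)) sums Re (h z)"
    proof -
      have "summable (\<lambda>n. b n z)"
        by (rule summable_comparison_test'[OF summable_exp_Suc[OF assms(1), of 2], of 0]) (use bound z in auto)
      then show ?thesis
        unfolding h_def by (intro sums_Re summable_sums)
    qed
    moreover have "(\<lambda>n. Re (w ^ Suc n / of_nat (Suc n))) sums Re (- Ln (1 - w))"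
      by (intro sums_Re sums_Ln_one_minus w)
    ultimately have "Re (h z) = Re (- Ln (1 - w))"
      using sums_unique2 by simp
    moreover have nz: "1 - w \<noteq> 0"
      using w by auto
    ultimately have "exp (Re (h z)) = inverse (cmod (1 - w))"
      by (simp add: exp_minus)
    moreover have "cmod (s z) = cmod (1 - w)"
    proof -
      have "exp (\<i> * u) = exp (- (\<i> * u)) * w"
        unfolding w_def exp_add[symmetric] by (rule arg_cong) simp
      then have "sin u = exp (- (\<i> * u)) * (w - 1) / (2 * \<i>)"
        unfolding sin_exp_eq by (simp add: algebra_simps)
      then have "cmod z = exp \<tau> * cmod (1 - w) / 2"
        using u by (simp add: norm_mult norm_divide norm_exp norm_minus_commute)
      moreover have "cmod (s z) = 2 * exp (- \<tau>) * cmod z"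
        unfolding s_def norm_mult norm_of_real by simp
      ultimately show ?thesis
        by (simp add: exp_minus field_simps)
    qed
    ultimately show ?thesis
      using nz by (simp add: norm_mult norm_exp)
  qed
  have sd: "deriv s 0 = of_real (2 * exp (- \<tau>))" "deriv (deriv s) 0 = 0" "(deriv ^^ 3) s 0 = 0"
    unfolding s_def by (simp_all add: numeral_3_eq_3)
  have "ND D \<longleftrightarrow> cmod ((deriv ^^ 3) s 0 + 3 * deriv s 0 * deriv (deriv h) 0)
    / (cmod (deriv s 0) ^ 3 * exp (2 * Re (h 0))) \<notin> resonant_values"
  proof (rule ND_iff_explicit[OF E(1-5) _ E(6) _ series(1) _ _ _ _ series(2) h1 boundary \<open>v \<noteq> 0\<close> D[folded E_def]])
    show "compact K"
      unfolding K_def by (rule std_ellipse_closed_compact[OF ab])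
    show "continuous_on K s" "s holomorphic_on E"
      unfolding s_def by (intro continuous_intros holomorphic_intros)+
  qed (auto simp: sd, auto simp: s_def)
  also have "cmod ((deriv ^^ 3) s 0 + 3 * deriv s 0 * deriv (deriv h) 0)
      / (cmod (deriv s 0) ^ 3 * exp (2 * Re (h 0)))
    = 6 / x * lambert (\<lambda>n. real (Suc n)) (x\<^sup>2) * exp (- (4 * lambert (\<lambda>n. 1 / real (Suc n)) (x\<^sup>2)))"
  proof -
    define A where "A = lambert (\<lambda>n. real (Suc n)) (x\<^sup>2)"
    define B where "B = lambert (\<lambda>n. 1 / real (Suc n)) (x\<^sup>2)"
    have "A > 0"
      unfolding A_def using x21 by (intro lambert_pos) auto
    \<comment> \<open>48 = 3 * 2 * 8: the Leibniz coefficient,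
      \<open>deriv s 0 = 2 * exp (- \<tau>)\<close>, and \<open>- 8 * A\<close> from
      \<open>h\<close>. Division by the cube of \<open>deriv s 0\<close> then leaves
      \<open>6 / x\<close>.\<close>
    have n: "cmod ((deriv ^^ 3) s 0 + 3 * deriv s 0 * deriv (deriv h) 0) = 48 * exp (- \<tau>) * A"
    proof -
      have "(deriv ^^ 3) s 0 + 3 * deriv s 0 * deriv (deriv h) 0 = of_real (- (48 * exp (- \<tau>) * A))"
        unfolding sd h2 A_def by simp
      then show ?thesis
        using \<open>A > 0\<close> by (simp only: norm_of_real) simp
    qed
    have d: "cmod (deriv s 0) = 2 * exp (- \<tau>)"
      unfolding sd norm_of_real by simp
    have x: "x = exp (- \<tau>) * exp (- \<tau>)"
      by (simp add: x_def flip: exp_add)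
    have "2 * Re (h 0) = 4 * B"
      by (simp add: h0 B_def)
    then have "48 * exp (- \<tau>) * A / ((2 * exp (- \<tau>)) ^ 3 * exp (2 * Re (h 0))) = 6 / x * A * exp (- (4 * B))"
      unfolding x by (simp add: power3_eq_cube exp_minus field_simps)
    then show ?thesis
      unfolding n d A_def B_def .
  qed
  finally show ?thesis .
qed

section \<open>Rectangles\<close>

definition std_rectangle :: "real \<Rightarrow> real \<Rightarrow> complex set" where
  "std_rectangle a b = {z. \<bar>Re z\<bar> < a \<and> \<bar>Im z\<bar> < b}"

definition std_rectangle_closed :: "real \<Rightarrow> real \<Rightarrow> complex set" where
  "std_rectangle_closed a b = {z. \<bar>Re z\<bar> \<le> a \<and> \<bar>Im z\<bar> \<le> b}"

lemma std_rectangle_closed_compact: "compact (std_rectangle_closed a b)"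
proof -
  have "closed (std_rectangle_closed a b)"
    unfolding std_rectangle_closed_def by (intro closed_Collect_conj closed_Collect_le continuous_intros)
  moreover have "cmod z \<le> a + b" if "z \<in> std_rectangle_closed a b" for z
    using that cmod_le[of z] by (simp add: std_rectangle_closed_def)
  ultimately show ?thesis
    by (auto simp: compact_eq_bounded_closed bounded_iff)
qed

lemma std_rectangle_props:
  assumes "a > 0" "b > 0"
  shows "open (std_rectangle a b)" "convex (std_rectangle a b)" "bounded (std_rectangle a b)"
    "0 \<in> std_rectangle a b" "z \<in> std_rectangle a b \<Longrightarrow> - z \<in> std_rectangle a b"
    "std_rectangle a b \<subseteq> std_rectangle_closed a b"
proof -
  show "open (std_rectangle a b)"
    unfolding std_rectangle_def by (intro open_Collect_conj open_Collect_less continuous_intros)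
  have eq: "std_rectangle a b = Re -` {- a<..<a} \<inter> Im -` {- b<..<b}"
    by (auto simp: std_rectangle_def)
  show "convex (std_rectangle a b)"
    unfolding eq by (intro convex_Int convex_linear_vimage bounded_linear.linear[OF bounded_linear_Re]
        bounded_linear.linear[OF bounded_linear_Im]) auto
  show "std_rectangle a b \<subseteq> std_rectangle_closed a b"
    by (auto simp: std_rectangle_def std_rectangle_closed_def)
  then show "bounded (std_rectangle a b)"
    using std_rectangle_closed_compact bounded_subset compact_imp_bounded by blast
qed (use assms in \<open>auto simp: std_rectangle_def\<close>)

lemma norm_cosh_le_exp: "cmod (cosh z) \<le> exp \<bar>Re z\<bar>"
  using norm_cos_le_exp[of "\<i> * z"] by (simp add: cosh_conv_cos)

lemma cosh_mult_derivs:
  fixes C w :: complex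
  defines "f \<equiv> \<lambda>z. C * cosh (w * z)"
  shows "deriv f 0 = 0" "deriv (deriv f) 0 = C * w\<^sup>2"
proof -
  have "(f has_field_derivative C * (sinh (w * z) * w)) (at z)" for z
    unfolding f_def by (auto intro!: derivative_eq_intros)
  then have d: "deriv f = (\<lambda>z. C * (sinh (w * z) * w))"
    by (intro ext DERIV_imp_deriv)
  have "((\<lambda>z. C * (sinh (w * z) * w)) has_field_derivative C * w\<^sup>2) (at 0)"
    by (auto intro!: derivative_eq_intros simp: power2_eq_square)
  then show "deriv (deriv f) 0 = C * w\<^sup>2"
    unfolding d by (rule DERIV_imp_deriv)
  show "deriv f 0 = 0"
    by (simp add: d)
qed

text \<open>The function \<open>s\<close> is \<open>tanh\<close>, which maps the strip \<open>\<bar>Im z\<bar> < \<pi> / 4\<close> onto the disc. The series \<open>h\<close>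
  corrects its modulus on the vertical sides and, containing only odd frequencies, is purely
  imaginary on the horizontal ones.\<close>

lemma ND_rectangle_iff:
  assumes "X > 0" "v \<noteq> 0" and D: "D = (\<lambda>z. c + v * z) ` std_rectangle X (pi / 4)"
  defines "p \<equiv> exp (- 4 * X)"
  shows "ND D \<longleftrightarrow> \<bar>(48 * lambert (\<lambda>n. of_bool (even n) * real (Suc n)) p - 2)
    * exp (- (8 * lambert (\<lambda>n. of_bool (even n) / real (Suc n)) p))\<bar> \<notin> resonant_values"
proof -
  have ab: "X > 0" "pi / 4 > 0"
    using assms(1) by auto
  define E where "E = std_rectangle X (pi / 4)"
  define K where "K = std_rectangle_closed X (pi / 4)"
  note E = std_rectangle_props[OF ab, folded E_def K_def]
  have p: "0 < p" "p < 1"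
    using assms(1) by (simp_all add: p_def)
  define L where "L = (\<lambda>k. p ^ k / (1 + p ^ k))"
  \<comment> \<open>On the side \<open>Re z = X\<close> the datum - ln |tanh z| is twice the real
    part of artanh w with w = exp (- 2 z), whose terms are 2 w^k / k for odd k. The factor 1/2 in
    \<open>cosh (2 * k * X) * L k = exp (- 2 * k * X) / 2\<close> raises the weight to
    \<open>4 / k\<close>; \<open>even n\<close> means odd \<open>k = Suc n\<close>.\<close>
  define b where "b = (\<lambda>n z. complex_of_real (of_bool (even n) * 4 / real (Suc n))
      * (cosh (of_nat (2 * Suc n) * z) * of_real (L (Suc n))))"
  define h where "h = (\<lambda>z. \<Sum>n. b n z)"
  \<comment> \<open>\<open>tanh\<close> expressed in w = exp (- 2 z), so that its modulus is |1 - w|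
    / |1 + w|, matching the logarithms in \<open>h\<close>.\<close>
  define s where "s = (\<lambda>z::complex. (1 - exp (- 2 * z)) / (1 + exp (- 2 * z)))"
  have bh: "b n holomorphic_on S" for n S
    unfolding b_def cosh_field_def by (intro holomorphic_intros) auto
  have bc: "continuous_on S (b n)" for n S
    by (rule holomorphic_on_imp_continuous_on[OF bh])
  have bound: "cmod (b n z) \<le> 4 * exp (- 2 * real (Suc n) * X)" if z: "z \<in> K" for n z
  proof -
    define k where "k = Suc n"
    have "k \<ge> 1"
      by (simp add: k_def)
    have "cmod (cosh (of_nat (2 * k) * z)) \<le> exp \<bar>Re (of_nat (2 * k) * z)\<bar>"
      by (rule norm_cosh_le_exp)
    also have "\<dots> \<le> exp (2 * real k * X)"
    proof -
      have "\<bar>Re (of_nat (2 * k) * z)\<bar> = 2 * real k * \<bar>Re z\<bar>"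
        by (simp add: abs_mult)
      also have "\<dots> \<le> 2 * real k * X"
        using z by (intro mult_left_mono) (auto simp: K_def std_rectangle_closed_def)
      finally show ?thesis
        by simp
    qed
    finally have "cmod (cosh (of_nat (2 * k) * z) * of_real (L k)) \<le> exp (- 2 * real k * X)"
      unfolding L_def p_def using assms(1) by (intro norm_lambert_factor)
    moreover have "cmod (complex_of_real (of_bool (even n) * 4 / real k)) \<le> 4"
      unfolding norm_of_real using \<open>k \<ge> 1\<close> by (simp add: divide_le_eq)
    ultimately have "cmod (complex_of_real (of_bool (even n) * 4 / real k)) * cmod (cosh (of_nat (2 * k) * z) * of_real (L k))
        \<le> 4 * exp (- 2 * real k * X)"
      by (intro mult_mono) auto
    then show ?thesis
      by (simp only: b_def norm_mult k_def)
  qed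
  have series: "continuous_on K h" "h holomorphic_on E"
    "\<And>m z. z \<in> E \<Longrightarrow> (\<lambda>n. (deriv ^^ m) (b n) z) sums (deriv ^^ m) h z"
    unfolding h_def
    by (rule holomorphic_series[OF E(1,6) bh bc bound summable_exp_Suc[OF assms(1)]]; assumption)+
  have lam: "(\<lambda>n. f n * L (Suc n)) sums lambert f p" if "\<And>n. \<bar>f n\<bar> \<le> real (Suc n)" for f
    using summable_sums[OF summable_lambert[of p f]] p that by (simp add: lambert_def L_def)
  have b_alt: "b n = (\<lambda>z. of_real (of_bool (even n) * 4 / real (Suc n) * L (Suc n)) * cosh (of_nat (2 * Suc n) * z))" for n
    by (simp add: b_def fun_eq_iff)
  have inv_le: "\<bar>of_bool (even n) / real (Suc n)\<bar> \<le> real (Suc n)" for n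
    by (rule order_trans[of _ 1]) auto
  have h0: "h 0 = of_real (4 * lambert (\<lambda>n. of_bool (even n) / real (Suc n)) p)"
  proof -
    have "(\<lambda>n. 4 * (of_bool (even n) / real (Suc n) * L (Suc n))) sums (4 * lambert (\<lambda>n. of_bool (even n) / real (Suc n)) p)"
      by (intro sums_mult lam inv_le)
    then have "(\<lambda>n. complex_of_real (4 * (of_bool (even n) / real (Suc n) * L (Suc n)))) sums of_real (4 * lambert (\<lambda>n. of_bool (even n) / real (Suc n)) p)"
      by (rule sums_of_real)
    moreover have "complex_of_real (4 * (of_bool (even n) / real (Suc n) * L (Suc n))) = (deriv ^^ 0) (b n) 0" for n
      by (simp add: b_alt)
    ultimately show ?thesis
      using series(3)[OF E(4), of 0] by (simp add: sums_iff)
  qed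
  have h1: "deriv h 0 = 0"
  proof -
    have "(deriv ^^ 1) (b n) 0 = 0" for n
    proof -
      have "deriv (b n) 0 = 0"
        unfolding b_alt by (rule cosh_mult_derivs(1))
      then show ?thesis
        by simp
    qed
    then have "(\<lambda>n. 0) sums (deriv ^^ 1) h 0"
      using series(3)[OF E(4), of 1] by (simp only:)
    then show ?thesis
      by (simp add: sums_iff)
  qed
  have h2: "deriv (deriv h) 0 = of_real (16 * lambert (\<lambda>n. of_bool (even n) * real (Suc n)) p)"
  proof -
    have "(\<lambda>n. 16 * (of_bool (even n) * real (Suc n) * L (Suc n))) sums (16 * lambert (\<lambda>n. of_bool (even n) * real (Suc n)) p)"
      by (intro sums_mult lam) auto
    then have "(\<lambda>n. complex_of_real (16 * (of_bool (even n) * real (Suc n) * L (Suc n)))) sums of_real (16 * lambert (\<lambda>n. of_bool (even n) * real (Suc n)) p)"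
      by (rule sums_of_real)
    moreover have "complex_of_real (16 * (of_bool (even n) * real (Suc n) * L (Suc n))) = (deriv ^^ 2) (b n) 0" for n
    proof -
      define k where "k = Suc n"
      have "k > 0"
        by (simp add: k_def)
      have "deriv (deriv (b n)) 0 = of_real (of_bool (even n) * 4 / real k * L k) * (of_nat (2 * k))\<^sup>2"
        unfolding b_alt k_def by (rule cosh_mult_derivs(2))
      then have "(deriv ^^ 2) (b n) 0 = of_real (of_bool (even n) * 4 / real k * L k) * (of_nat (2 * k))\<^sup>2"
        by (simp add: numeral_2_eq_2)
      also have "\<dots> = of_real (16 * (of_bool (even n) * real k * L k))"
        using \<open>k > 0\<close> by (simp add: power2_eq_square)
      finally show ?thesis
        by (simp only: k_def)
    qed
    ultimately have "(deriv ^^ 2) h 0 = of_real (16 * lambert (\<lambda>n. of_bool (even n) * real (Suc n)) p)"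
      using series(3)[OF E(4), of 2] by (simp only: sums_iff)
    then show ?thesis
      by (simp add: numeral_2_eq_2)
  qed
  \<comment> \<open>For \<open>\<bar>Im z\<bar> \<le> pi / 4\<close> the value exp (- 2 z) lies in
    the closed right half-plane and so differs from -1, even on the boundary.\<close>
  have Re_exp_nonneg: "Re (exp (- 2 * z)) \<ge> 0" if "z \<in> K" for z
    using that by (auto simp: K_def std_rectangle_closed_def Re_exp intro!: mult_nonneg_nonneg cos_ge_zero)
  have denom: "1 + exp (- 2 * z) \<noteq> 0" if "z \<in> K" for z
    using Re_exp_nonneg[OF that] by (auto simp: complex_eq_iff)
  have denomE: "1 + exp (- 2 * z) \<noteq> 0" if "z \<in> E" for z
    using denom E(6) that by blast
  \<comment> \<open>The Riccati equation of \<open>tanh\<close> makes the higher derivatives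
    algebraic in \<open>s\<close>; at 0 they are 1, 0 and -2.\<close>
  have s': "(s has_field_derivative 1 - (s z)\<^sup>2) (at z)" if "z \<in> E" for z
    unfolding s_def using denomE[OF that]
    by (auto intro!: derivative_eq_intros simp: divide_simps) (simp add: power2_eq_square algebra_simps)
  have s0: "s 0 = 0"
    by (simp add: s_def)
  have s1: "deriv s z = 1 - (s z)\<^sup>2" if "z \<in> E" for z
    using s'[OF that] by (rule DERIV_imp_deriv)
  have s'': "(deriv s has_field_derivative - 2 * s z * (1 - (s z)\<^sup>2)) (at z)" if "z \<in> E" for z
  proof (rule has_field_derivative_transform_within_open[where S = E])
    show "((\<lambda>z. 1 - (s z)\<^sup>2) has_field_derivative - 2 * s z * (1 - (s z)\<^sup>2)) (at z)"
      by (auto intro!: derivative_eq_intros s' that)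
  qed (use E(1) s1 that in auto)
  have s2: "deriv (deriv s) z = - 2 * s z * (1 - (s z)\<^sup>2)" if "z \<in> E" for z
    using s''[OF that] by (rule DERIV_imp_deriv)
  have "(deriv (deriv s) has_field_derivative - 2) (at 0)"
  proof (rule has_field_derivative_transform_within_open[where S = E])
    show "((\<lambda>z. - 2 * s z * (1 - (s z)\<^sup>2)) has_field_derivative - 2) (at 0)"
      by (auto intro!: derivative_eq_intros s' E(4) simp: s0)
  qed (use E(1,4) s2 in auto)
  then have s3: "(deriv ^^ 3) s 0 = - 2"
    by (simp add: numeral_3_eq_3 DERIV_imp_deriv)
  have sums_h: "(\<lambda>n. Re (b n z)) sums Re (h z)" if z: "z \<in> K" for z
  proof -
    have "summable (\<lambda>n. b n z)"
      by (rule summable_comparison_test'[OF summable_exp_Suc[OF assms(1), of 4], of 0]) (use bound z in auto)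
    then show ?thesis
      unfolding h_def by (intro sums_Re summable_sums)
  qed
  have Re_b: "Re (b n z) = of_bool (even n) * 4 / real (Suc n)
      * (cosh (2 * real (Suc n) * Re z) * cos (2 * real (Suc n) * Im z)) * L (Suc n)" for n z
  proof -
    define k where "k = Suc n"
    have "Re (b n z) = of_bool (even n) * 4 / real k * (Re (cosh (of_nat (2 * k) * z)) * L k)"
      unfolding b_def k_def[symmetric]
      by (simp only: Re_complex_of_real Im_complex_of_real times_complex.sel) simp
    also have "\<dots> = of_bool (even n) * 4 / real k * (cosh (2 * real k * Re z) * cos (2 * real k * Im z)) * L k"
      unfolding Re_cosh_cos by simp
    finally show ?thesis
      unfolding k_def .
  qed
  \<comment> \<open>The artanh series needs \<open>cmod w < 1\<close>, which holds on the right
    side; the left side follows because \<open>s\<close> is odd and \<open>h\<close> is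
    even.\<close>
  have right: "cmod (s z * exp (h z)) = 1" if z: "z \<in> K" "Re z = X" for z
  proof -
    define w where "w = exp (- 2 * z)"
    have w: "cmod w < 1"
      using z(2) assms(1) by (simp add: w_def norm_exp)
    have "Re (b n z) = Re (2 * (of_bool (even n) * w ^ Suc n / of_nat (Suc n)))" for n
    proof -
      define k where "k = Suc n"
      have wk: "Re (w ^ k) = exp (- 2 * real k * X) * cos (2 * real k * Im z)"
        unfolding w_def exp_of_nat_mult[symmetric] Re_exp using z(2) by (simp add: algebra_simps)
      have "Re (b n z) = of_bool (even n) * 4 / real k
          * (cos (2 * real k * Im z) * (cosh (2 * real k * X) * L k))"
        unfolding Re_b k_def[symmetric] z(2) by simp
      also have "cosh (2 * real k * X) * L k = exp (- 2 * real k * X) / 2"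
        unfolding L_def p_def by (rule cosh_mult_lambert_factor)
      also have "of_bool (even n) * 4 / real k * (cos (2 * real k * Im z) * (exp (- 2 * real k * X) / 2))
          = 2 * (of_bool (even n) * Re (w ^ k) / real k)"
        unfolding wk by simp
      also have "\<dots> = Re (2 * (of_bool (even n) * w ^ k / of_nat k))"
        by (simp add: Re_divide_of_nat)
      finally show ?thesis
        by (simp only: k_def)
    qed
    moreover have "(\<lambda>n. Re (2 * (of_bool (even n) * w ^ Suc n / of_nat (Suc n))))
        sums Re (2 * ((Ln (1 + w) - Ln (1 - w)) / 2))"
      by (intro sums_Re sums_mult sums_odd_terms_Ln w)
    ultimately have "Re (h z) = Re (Ln (1 + w)) - Re (Ln (1 - w))"
      using sums_unique2[OF sums_h[OF z(1)]] by simp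
    moreover have nz: "1 - w \<noteq> 0" "1 + w \<noteq> 0"
      using w by (auto simp: add_eq_0_iff)
    ultimately have "exp (Re (h z)) = cmod (1 + w) / cmod (1 - w)"
      by (simp add: exp_diff)
    moreover have "cmod (s z) = cmod (1 - w) / cmod (1 + w)"
      by (simp add: s_def w_def norm_divide)
    ultimately show ?thesis
      using nz by (simp add: norm_mult norm_exp)
  qed
  have boundary: "cmod (s z * exp (h z)) = 1" if z: "z \<in> K - E" for z
  proof -
    consider "Re z = X" | "Re z = - X" | "\<bar>Im z\<bar> = pi / 4"
      using z by (force simp: K_def E_def std_rectangle_closed_def std_rectangle_def)
    then show ?thesis
    proof cases
      case 1
      then show ?thesis
        using right z by blast
    next
      case 2
      have "- z \<in> K"
        using z by (simp add: K_def std_rectangle_closed_def)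
      then have "cmod (s (- z) * exp (h (- z))) = 1"
        using right 2 by simp
      moreover have "h (- z) = h z"
        by (simp add: h_def b_def)
      moreover have "s (- z) = - s z"
      proof -
        define w where "w = exp (- 2 * z)"
        have "w \<noteq> 0"
          by (simp add: w_def)
        then have "1 - inverse w = (w - 1) / w" "1 + inverse w = (w + 1) / w"
          by (simp_all add: field_simps)
        moreover have "s (- z) = (1 - inverse w) / (1 + inverse w)" "s z = (1 - w) / (1 + w)"
          by (simp_all add: s_def w_def flip: exp_minus)
        ultimately show ?thesis
          using \<open>w \<noteq> 0\<close> by (simp add: minus_divide_left add.commute)
      qed
      ultimately show ?thesis
        by (simp add: norm_mult)
    next
      case 3
      \<comment> \<open>For odd \<open>k\<close> the angle
        \<open>2 * k * \<bar>Im z\<bar> = k * pi / 2\<close> is an odd multiple of pi / 2, so each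
        mode in \<open>h\<close> is purely imaginary on the horizontal sides.\<close>
      have "cos (2 * real (Suc n) * Im z) = 0" if "even n" for n
      proof -
        obtain m where n: "n = 2 * m"
          using \<open>even n\<close> by blast
        have "cos (2 * real (Suc n) * Im z) = cos (2 * real (Suc n) * \<bar>Im z\<bar>)"
          by (simp add: abs_if)
        also have "2 * real (Suc n) * \<bar>Im z\<bar> = real m * pi + pi / 2"
          unfolding 3 n by (simp add: algebra_simps)
        also have "cos \<dots> = 0"
          by (simp add: cos_add)
        finally show ?thesis .
      qed
      then have "Re (b n z) = 0" for n
        unfolding Re_b by (cases "even n") simp_all
      then have "Re (h z) = 0"
        using sums_h[of z] z by (simp add: sums_iff)
      moreover have "cmod (s z) = 1"
      proof -
        define w where "w = exp (- 2 * z)"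
        have "cos (2 * Im z) = cos (2 * \<bar>Im z\<bar>)"
          by (simp add: abs_if)
        then have "Re w = 0"
          by (simp add: w_def Re_exp 3)
        then have "cmod (1 - w) = cmod (1 + w)"
          by (simp add: cmod_def)
        moreover have "1 + w \<noteq> 0"
          using denom[of z] z by (simp add: w_def)
        moreover have "s z = (1 - w) / (1 + w)"
          by (simp add: s_def w_def)
        ultimately show ?thesis
          by (simp add: norm_divide)
      qed
      ultimately show ?thesis
        by (simp add: norm_mult norm_exp)
    qed
  qed
  have s_zero: "s z = 0 \<longleftrightarrow> z = 0" if z: "z \<in> E" for z
  proof
    assume "s z = 0"
    then have "exp (- 2 * z) = 1"
      using denomE[OF z] by (simp add: s_def)
    then obtain n :: int where n: "Re (- 2 * z) = 0" "Im (- 2 * z) = of_int (2 * n) * pi"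
      unfolding exp_eq_1 by blast
    then have "of_int n * pi = - Im z"
      by simp
    moreover have "\<bar>Im z\<bar> < pi / 4"
      using z by (simp add: E_def std_rectangle_def)
    ultimately have "\<bar>of_int n * pi\<bar> < 1 * pi"
      using pi_gt_zero by linarith
    then have "\<bar>real_of_int n\<bar> < 1"
      by (simp add: abs_mult)
    then have "n = 0"
      by linarith
    then show "z = 0"
      using n by (simp add: complex_eq_iff)
  qed (simp add: s0)
  have "ND D \<longleftrightarrow> cmod ((deriv ^^ 3) s 0 + 3 * deriv s 0 * deriv (deriv h) 0)
    / (cmod (deriv s 0) ^ 3 * exp (2 * Re (h 0))) \<notin> resonant_values"
  proof (rule ND_iff_explicit[OF E(1-5) _ E(6) _ series(1) _ s_zero _ _ series(2) h1 boundary \<open>v \<noteq> 0\<close> D[folded E_def]])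
    show "compact K"
      unfolding K_def by (rule std_rectangle_closed_compact)
    show "continuous_on K s"
      unfolding s_def by (intro continuous_intros ballI denom)
    show "s holomorphic_on E"
      unfolding s_def by (intro holomorphic_intros denomE)
    show "deriv s 0 \<noteq> 0" "deriv (deriv s) 0 = 0"
      using s1[OF E(4)] s2[OF E(4)] by (simp_all add: s0)
  qed
  also have "cmod ((deriv ^^ 3) s 0 + 3 * deriv s 0 * deriv (deriv h) 0)
      / (cmod (deriv s 0) ^ 3 * exp (2 * Re (h 0)))
    = \<bar>(48 * lambert (\<lambda>n. of_bool (even n) * real (Suc n)) p - 2)
      * exp (- (8 * lambert (\<lambda>n. of_bool (even n) / real (Suc n)) p))\<bar>"
  proof -
    define A where "A = lambert (\<lambda>n. of_bool (even n) * real (Suc n)) p"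
    define B where "B = lambert (\<lambda>n. of_bool (even n) / real (Suc n)) p"
    have d: "deriv s 0 = 1"
      using s1[OF E(4)] by (simp add: s0)
    \<comment> \<open>The -2 is the third derivative of \<open>tanh\<close>; 48 = 3 * 16, where the
      16 comes from \<open>4 / k\<close> times \<open>(2 * k)^2 = 4 * k^2\<close> in
      \<open>h2\<close>.\<close>
    have "(deriv ^^ 3) s 0 + 3 * deriv s 0 * deriv (deriv h) 0 = of_real (48 * A - 2)"
      unfolding s3 d h2 A_def by simp
    moreover have "2 * Re (h 0) = 8 * B"
      by (simp add: h0 B_def)
    ultimately show ?thesis
      unfolding d A_def[symmetric] B_def[symmetric]
      by (simp only: norm_of_real) (simp add: abs_mult exp_minus divide_inverse)
  qed
  finally show ?thesis .
qed

section \<open>Countability of the exceptional ratios\<close>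

lemma std_ellipse_scale:
  assumes "r > 0"
  shows "std_ellipse (r * a) (r * b) = (\<lambda>z. of_real r * z) ` std_ellipse a b"
proof (intro equalityI subsetI)
  fix z assume "z \<in> std_ellipse (r * a) (r * b)"
  then have "z / of_real r \<in> std_ellipse a b"
    by (simp add: std_ellipse_def)
  then show "z \<in> (\<lambda>z. of_real r * z) ` std_ellipse a b"
    using assms by (intro image_eqI[of _ _ "z / of_real r"]) auto
qed (use assms in \<open>auto simp: std_ellipse_def\<close>)

lemma std_rectangle_scale:
  assumes "r > 0"
  shows "std_rectangle (r * a) (r * b) = (\<lambda>z. of_real r * z) ` std_rectangle a b"
proof (intro equalityI subsetI)
  fix z assume "z \<in> std_rectangle (r * a) (r * b)"
  then have "z / of_real r \<in> std_rectangle a b"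
    using assms by (simp add: std_rectangle_def divide_less_eq mult.commute)
  then show "z \<in> (\<lambda>z. of_real r * z) ` std_rectangle a b"
    using assms by (intro image_eqI[of _ _ "z / of_real r"]) auto
qed (use assms in \<open>auto simp: std_rectangle_def abs_mult\<close>)

text \<open>The modulus |F'''(0) / F'(0)| for semi-axes a > b, as a function of x = (a - b) / (a +
  b); the nome is x^2.\<close>

definition ellipse_modulus :: "real \<Rightarrow> real" where
  "ellipse_modulus x = 6 / x * lambert (\<lambda>n. real (Suc n)) (x\<^sup>2)
    * exp (- (4 * lambert (\<lambda>n. 1 / real (Suc n)) (x\<^sup>2)))"

text \<open>The same modulus for a rectangle with sides L and l, as a function of the nome p = exp
  (- pi L / l).\<close>

definition rectangle_modulus :: "real \<Rightarrow> real" where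
  "rectangle_modulus p = \<bar>(48 * lambert (\<lambda>n. of_bool (even n) * real (Suc n)) p - 2)
    * exp (- (8 * lambert (\<lambda>n. of_bool (even n) / real (Suc n)) p))\<bar>"

text \<open>Scaling puts the foci at 1 and -1, so that tanh \<tau> = b / a, equivalently exp (- 2
  \<tau>) = (a - b) / (a + b). A circle has no such normal form, whence
  \<open>b < a\<close>.\<close>

lemma ND_iff_ellipse_modulus:
  assumes "0 < b" "b < a" and D: "is_ellipse a b D"
  shows "ND D \<longleftrightarrow> ellipse_modulus ((a / b - 1) / (a / b + 1)) \<notin> resonant_values"
proof -
  obtain c u where u: "cmod u = 1" and D: "D = (\<lambda>z. c + u * z) ` std_ellipse a b"
    using D by (auto simp: is_ellipse_def std_ellipse_def image_def)
  define x where "x = (a - b) / (a + b)"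
  have x: "0 < x" "x < 1"
    using assms by (auto simp: x_def divide_less_eq)
  define \<tau> where "\<tau> = - ln x / 2"
  have "\<tau> > 0"
    using x by (simp add: \<tau>_def)
  have x\<tau>: "exp (- 2 * \<tau>) = x"
    using x by (simp add: \<tau>_def)
  define r where "r = b / sinh \<tau>"
  have "r > 0"
    using \<open>\<tau> > 0\<close> assms by (simp add: r_def)
  have b: "r * sinh \<tau> = b"
    using \<open>\<tau> > 0\<close> by (simp add: r_def)
  have a: "r * cosh \<tau> = a"
  proof -
    have "tanh \<tau> = b / a"
    proof -
      have "1 - x = 2 * b / (a + b)" "1 + x = 2 * a / (a + b)"
        using assms by (simp_all add: x_def field_simps)
      then show ?thesis
        unfolding tanh_real_altdef x\<tau> using assms by simp
    qed
    then have "a * sinh \<tau> = b * cosh \<tau>"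
      using assms by (simp add: tanh_def field_simps)
    then show ?thesis
      using \<open>\<tau> > 0\<close> by (simp add: r_def nonzero_divide_eq_eq)
  qed
  have "D = (\<lambda>z. c + (u * of_real r) * z) ` std_ellipse (cosh \<tau>) (sinh \<tau>)"
    unfolding D a[symmetric] b[symmetric] std_ellipse_scale[OF \<open>r > 0\<close>] by (simp add: image_image mult.assoc)
  then have "ND D \<longleftrightarrow> ellipse_modulus x \<notin> resonant_values"
    unfolding ellipse_modulus_def x\<tau>[symmetric]
    by (intro ND_ellipse_iff \<open>\<tau> > 0\<close>) (use u \<open>r > 0\<close> in auto)
  also have "x = (a / b - 1) / (a / b + 1)"
  proof -
    have "a / b - 1 = (a - b) / b" "a / b + 1 = (a + b) / b"
      using assms by (simp_all add: field_simps)
    then show ?thesis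
      using assms by (simp add: x_def)
  qed
  finally show ?thesis .
qed

text \<open>The half-height is scaled to pi / 4, which fits the strip that \<open>tanh\<close> maps
  onto the disc; the half-length becomes \<open>X\<close>, the only remaining parameter of the
  shape.\<close>

lemma ND_iff_rectangle_modulus:
  assumes "0 < l" "0 < L" and D: "is_rectangle L l D"
  shows "ND D \<longleftrightarrow> rectangle_modulus (exp (- pi / (l / L))) \<notin> resonant_values"
proof -
  obtain c u where u: "cmod u = 1" and D: "D = (\<lambda>z. c + u * z) ` std_rectangle (L / 2) (l / 2)"
    using D by (auto simp: is_rectangle_def std_rectangle_def image_def)
  define r where "r = 2 * l / pi"
  have "r > 0"
    using assms by (simp add: r_def)
  define X where "X = pi * L / (4 * l)"
  have "X > 0"
    using assms by (simp add: X_def)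
  have sides: "L / 2 = r * X" "l / 2 = r * (pi / 4)"
    using assms by (simp_all add: r_def X_def)
  have "D = (\<lambda>z. c + (u * of_real r) * z) ` std_rectangle X (pi / 4)"
    unfolding D sides std_rectangle_scale[OF \<open>r > 0\<close>] by (simp add: image_image mult.assoc)
  then have "ND D \<longleftrightarrow> rectangle_modulus (exp (- 4 * X)) \<notin> resonant_values"
    unfolding rectangle_modulus_def
    by (intro ND_rectangle_iff \<open>X > 0\<close>) (use u \<open>r > 0\<close> in auto)
  also have "- 4 * X = - pi / (l / L)"
    using assms by (simp add: X_def)
  finally show ?thesis .
qed

lemma not_ND_disc:
  assumes "0 < a" "is_ellipse a a D"
  shows "\<not> ND D"
proof -
  obtain c u where u: "cmod u = 1" and D: "D = (\<lambda>z. c + u * z) ` std_ellipse a a"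
    using assms(2) by (auto simp: is_ellipse_def std_ellipse_def image_def)
  show ?thesis
    using std_ellipse_props[OF assms(1,1)] u
    by (intro ND_quarter_turn_symmetric[OF _ _ _ _ _ _ D]) (auto simp: std_ellipse_def)
qed

lemma not_ND_square:
  assumes "0 < a" "is_rectangle a a D"
  shows "\<not> ND D"
proof -
  obtain c u where u: "cmod u = 1" and D: "D = (\<lambda>z. c + u * z) ` std_rectangle (a / 2) (a / 2)"
    using assms(2) by (auto simp: is_rectangle_def std_rectangle_def image_def)
  have "a / 2 > 0"
    using assms(1) by simp
  then show ?thesis
    using std_rectangle_props[of "a / 2" "a / 2"] u
    by (intro ND_quarter_turn_symmetric[OF _ _ _ _ _ _ D]) (auto simp: std_rectangle_def)
qed

text \<open>Level 0 is set apart: the nonconstancy argument rests on the derivative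
  \<open>- v\<close>, which vanishes there, but positivity of the Lambert series shows that this
  level is never attained.\<close>

lemma countable_resonant_ellipse_modulus:
  "countable {x. 0 < x \<and> x < 1 \<and> ellipse_modulus x \<in> resonant_values}"
proof -
  have inv_le: "\<bar>1 / real (Suc n)\<bar> \<le> real (Suc n)" for n
    by (rule order_trans[of _ 1]) auto
  have pos: "ellipse_modulus x > 0" if "0 < x" "x < 1" for x
    unfolding ellipse_modulus_def using that
    by (intro mult_pos_pos divide_pos_pos lambert_pos) (auto simp: abs_square_less_1)
  have "countable {x. 0 < x \<and> x < 1 \<and> ellipse_modulus x = v}" for v
  proof (cases "v = 0")
    case True
    then have "{x. 0 < x \<and> x < 1 \<and> ellipse_modulus x = v} = {}"
      using pos by force
    then show ?thesis
      by (simp only: countable_empty)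
  next
    case False
    then show ?thesis
      unfolding ellipse_modulus_def by (intro countable_ellipse_level inv_le) auto
  qed
  then have "countable (\<Union>v\<in>resonant_values. {x. 0 < x \<and> x < 1 \<and> ellipse_modulus x = v})"
    by (intro countable_UN countable_resonant_values)
  then show ?thesis
    by (rule countable_subset[rotated]) auto
qed

text \<open>The absolute value is not analytic, so each level \<open>v\<close> is split into the
  levels \<open>v\<close> and \<open>- v\<close> of the signed function \<open>g\<close>.\<close>

lemma countable_resonant_rectangle_modulus:
  "countable {x. 0 < x \<and> x < 1 \<and> rectangle_modulus x \<in> resonant_values}"
proof -
  define g where "g = (\<lambda>p. (48 * lambert (\<lambda>n. of_bool (even n) * real (Suc n)) p - 2)
    * exp (- (8 * lambert (\<lambda>n. of_bool (even n) / real (Suc n)) p)) :: real)"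
  have inv_le: "\<bar>of_bool (even n) / real (Suc n)\<bar> \<le> real (Suc n)" for n
    by (rule order_trans[of _ 1]) auto
  have c: "countable {x. 0 < x \<and> x < 1 \<and> g x = v}" for v
    unfolding g_def by (intro countable_rectangle_level inv_le) auto
  have "countable (\<Union>v\<in>resonant_values. {x. 0 < x \<and> x < 1 \<and> g x = v} \<union> {x. 0 < x \<and> x < 1 \<and> g x = - v})"
    by (intro countable_UN countable_resonant_values countable_Un c)
  moreover have "rectangle_modulus = (\<lambda>p. \<bar>g p\<bar>)"
    by (simp add: rectangle_modulus_def g_def fun_eq_iff)
  ultimately show ?thesis
  proof (elim countable_subset[rotated], intro subsetI)
    fix x assume mod: "rectangle_modulus = (\<lambda>p. \<bar>g p\<bar>)"
      and "x \<in> {x. 0 < x \<and> x < 1 \<and> rectangle_modulus x \<in> resonant_values}"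
    then have "0 < x" "x < 1" "\<bar>g x\<bar> \<in> resonant_values"
      using fun_cong[OF mod, of x] by simp_all
    then show "x \<in> (\<Union>v\<in>resonant_values. {x. 0 < x \<and> x < 1 \<and> g x = v} \<union> {x. 0 < x \<and> x < 1 \<and> g x = - v})"
      by (intro UN_I[of "\<bar>g x\<bar>"]) (auto simp: abs_if)
  qed
qed

theorem proposition1p5:
  shows "(\<exists>G\<^sub>E :: real set. countable G\<^sub>E \<and> G\<^sub>E \<subseteq> {1<..} \<and>
            (\<forall>D a b. 0 < b \<and> b \<le> a \<and> is_ellipse a b D \<longrightarrow>
              (ND D \<longleftrightarrow> a \<noteq> b \<and> a / b \<notin> G\<^sub>E)))
       \<and> (\<exists>G\<^sub>R :: real set. countable G\<^sub>R \<and> G\<^sub>R \<subseteq> {0<..<1} \<and>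
            (\<forall>D l L. 0 < l \<and> l \<le> L \<and> is_rectangle L l D \<longrightarrow>
              (ND D \<longleftrightarrow> l \<noteq> L \<and> l / L \<notin> G\<^sub>R)))"
proof
  define GE where "GE = {t. 1 < t \<and> ellipse_modulus ((t - 1) / (t + 1)) \<in> resonant_values}"
  \<comment> \<open>The map x \<mapsto> (1 + x) / (1 - x) inverts t \<mapsto> (t - 1) / (t + 1),
    carrying countability from the parameter to the axis ratio.\<close>
  have "GE \<subseteq> (\<lambda>x. (1 + x) / (1 - x)) ` {x. 0 < x \<and> x < 1 \<and> ellipse_modulus x \<in> resonant_values}"
  proof
    fix t assume t: "t \<in> GE"
    then show "t \<in> (\<lambda>x. (1 + x) / (1 - x)) ` {x. 0 < x \<and> x < 1 \<and> ellipse_modulus x \<in> resonant_values}"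
      by (intro image_eqI[of _ _ "(t - 1) / (t + 1)"]) (auto simp: GE_def field_simps)
  qed
  then have 1: "countable GE"
    by (rule countable_subset) (intro countable_image countable_resonant_ellipse_modulus)
  have 2: "ND D \<longleftrightarrow> a \<noteq> b \<and> a / b \<notin> GE" if "0 < b" "b \<le> a" "is_ellipse a b D" for D a b
  proof (cases "a = b")
    case True
    then show ?thesis
      using not_ND_disc that by blast
  next
    case False
    then show ?thesis
      using ND_iff_ellipse_modulus[of b a D] that by (simp add: GE_def)
  qed
  show "\<exists>G\<^sub>E :: real set. countable G\<^sub>E \<and> G\<^sub>E \<subseteq> {1<..} \<and>
            (\<forall>D a b. 0 < b \<and> b \<le> a \<and> is_ellipse a b D \<longrightarrow>
              (ND D \<longleftrightarrow> a \<noteq> b \<and> a / b \<notin> G\<^sub>E))"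
    by (rule exI[of _ GE], intro conjI allI impI 1 2) (auto simp: GE_def)
next
  define GR where "GR = {t. 0 < t \<and> t < 1 \<and> rectangle_modulus (exp (- pi / t)) \<in> resonant_values}"
  \<comment> \<open>Likewise x \<mapsto> - pi / ln x inverts t \<mapsto> exp (- pi / t).\<close>
  have "GR \<subseteq> (\<lambda>x. - pi / ln x) ` {x. 0 < x \<and> x < 1 \<and> rectangle_modulus x \<in> resonant_values}"
  proof
    fix t assume t: "t \<in> GR"
    then show "t \<in> (\<lambda>x. - pi / ln x) ` {x. 0 < x \<and> x < 1 \<and> rectangle_modulus x \<in> resonant_values}"
      by (intro image_eqI[of _ _ "exp (- pi / t)"]) (auto simp: GR_def)
  qed
  then have 1: "countable GR"
    by (rule countable_subset) (intro countable_image countable_resonant_rectangle_modulus)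
  have 2: "ND D \<longleftrightarrow> l \<noteq> L \<and> l / L \<notin> GR" if "0 < l" "l \<le> L" "is_rectangle L l D" for D l L
  proof (cases "l = L")
    case True
    then show ?thesis
      using not_ND_square that by blast
  next
    case False
    then show ?thesis
      using ND_iff_rectangle_modulus[of l L D] that by (simp add: GR_def)
  qed
  show "\<exists>G\<^sub>R :: real set. countable G\<^sub>R \<and> G\<^sub>R \<subseteq> {0<..<1} \<and>
            (\<forall>D l L. 0 < l \<and> l \<le> L \<and> is_rectangle L l D \<longrightarrow>
              (ND D \<longleftrightarrow> l \<noteq> L \<and> l / L \<notin> G\<^sub>R))"
    by (rule exI[of _ GR], intro conjI allI impI 1 2) (auto simp: GR_def)
qed

end
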